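(* For every odd prime power $q$, $f\bigl(q^2+1,\,H(q^2-q-1,\,q,\,1)\bigr)=2$.
   Context: A hypergraph is a finite set of distinct finite sets (its edges); $|F|$ denotes the number of edges of $F$, and a subgraph of $F$ is a subset of its edges. A copy of $H$ in $F$ is a set of edges of $F$ which, as a hypergraph, is isomorphic to $H$. $F$ is $H$-free if it contains no copy of $H$. Let $\mathrm{ex}(F,H)$ be the maximum number of edges of an $H$-free subgraph of $F$, and $f(m,H):=\min_{|F|=m}\mathrm{ex}(F,H)$, the minimum being over all hypergraphs $F$ with $m$ edges (not necessarily uniform). For nonnegative integers $b_1,b_2,b_3$ with $b_1,b_2$ not both zero, $H(b_1,b_2,b_3)$ is the (unique up to isomorphism) 3-edge hypergraph $\{A_1,A_2,A_3\}$ in which, for each $\ell\in\{1,2,3\}$ and each $I\subseteq\{1,2,3\}$ with $|I|=\ell$, exactly $b_\ell$ vertices lie in all $A_i$, $i\in I$, and in no $A_i$, $i\notin I$. *)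

theory Defs
  imports "HOL-Number_Theory.Prime_Powers"
begin

definition hypergraph :: "'a set set \<Rightarrow> bool" where
  "hypergraph F \<longleftrightarrow> finite F \<and> (\<forall>e\<in>F. finite e)"

(* A hypergraph is just its set of edges, so its vertices are the elements of its edges. *)
definition hg_iso :: "'a set set \<Rightarrow> 'b set set \<Rightarrow> bool" where
  "hg_iso F G \<longleftrightarrow> (\<exists>\<phi>. bij_betw \<phi> (\<Union>F) (\<Union>G) \<and> (\<lambda>e. \<phi> ` e) ` F = G)"

definition is_copy :: "'b set set \<Rightarrow> 'a set set \<Rightarrow> 'a set set \<Rightarrow> bool" where
  "is_copy H F S \<longleftrightarrow> S \<subseteq> F \<and> hg_iso S H"

definition hg_free :: "'b set set \<Rightarrow> 'a set set \<Rightarrow> bool" where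
  "hg_free H F \<longleftrightarrow> \<not> (\<exists>S. is_copy H F S)"

definition ex_hg :: "'a set set \<Rightarrow> 'b set set \<Rightarrow> nat" where
  "ex_hg F H = Max {card G | G. G \<subseteq> F \<and> hg_free H G}"

(* The vertices are taken to be natural numbers: every hypergraph has only finitely many
   vertices, hence is isomorphic to one on natural numbers. The infimum ranges over a
   nonempty set of natural numbers, so it is a minimum. *)
definition f_hg :: "nat \<Rightarrow> 'b set set \<Rightarrow> nat" where
  "f_hg m H = Inf {ex_hg F H | F :: nat set set. hypergraph F \<and> card F = m}"

(* A vertex (I, j) lies in precisely the edges with index in I; for each index set I
   there are b_|I| of them. *)
definition H3_edge :: "nat \<Rightarrow> nat \<Rightarrow> nat \<Rightarrow> nat \<Rightarrow> (nat set \<times> nat) set" where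
  "H3_edge b1 b2 b3 i =
     {(I, j). I \<subseteq> {1, 2, 3} \<and> i \<in> I \<and>
        j < (if card I = 1 then b1 else if card I = 2 then b2 else b3)}"

definition H3 :: "nat \<Rightarrow> nat \<Rightarrow> nat \<Rightarrow> (nat set \<times> nat) set set" where
  "H3 b1 b2 b3 = H3_edge b1 b2 b3 ` {1, 2, 3}"

definition has_profile :: "nat \<Rightarrow> nat \<Rightarrow> nat \<Rightarrow> (nat \<Rightarrow> 'a set) \<Rightarrow> bool" where
  "has_profile b1 b2 b3 A \<longleftrightarrow>
     (\<forall>i\<in>{1, 2, 3}. finite (A i)) \<and> inj_on A {1, 2, 3} \<and>
     (\<forall>I. I \<subseteq> {1, 2, 3} \<and> I \<noteq> {} \<longrightarrow>
        card {v. (\<forall>i\<in>I. v \<in> A i) \<and> (\<forall>i\<in>{1, 2, 3} - I. v \<notin> A i)} =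
          (if card I = 1 then b1 else if card I = 2 then b2 else b3))"

(* H3 has the defining intersection pattern, and the pattern determines it up to isomorphism. *)
lemma H3_profile:
  assumes "b1 \<noteq> 0 \<or> b2 \<noteq> 0"
  shows "has_profile b1 b2 b3 (H3_edge b1 b2 b3)"
proof -
  define T :: "nat set" where "T = {1, 2, 3}"
  define c where "c I = (if card I = 1 then b1 else if card I = 2 then b2 else b3)" for I :: "nat set"
  let ?A = "H3_edge b1 b2 b3"
  have mem: "(I, j) \<in> ?A i \<longleftrightarrow> I \<subseteq> T \<and> i \<in> I \<and> j < c I" for I j i
    by (simp add: H3_edge_def T_def c_def)
  have T: "finite T" "card T = 3" by (simp_all add: T_def)
  have fin: "finite (?A i)" for i
  proof (rule finite_subset)
    have "c I \<le> b1 + b2 + b3" for I by (simp add: c_def)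
    then have "j < b1 + b2 + b3" if "j < c I" for I j
      using that less_le_trans by blast
    then show "?A i \<subseteq> Pow T \<times> {..< b1 + b2 + b3}"
      by (intro subrelI) (auto simp only: mem mem_Times_iff fst_conv snd_conv Pow_iff lessThan_iff)
  qed (simp add: T)
  have inj: "inj_on ?A T"
  proof (rule inj_onI, rule ccontr)
    fix i k assume ik: "i \<in> T" "k \<in> T" "?A i = ?A k" "i \<noteq> k"
    show False
    proof (cases "b1 = 0")
      case False
      then have "({i}, 0) \<in> ?A i" using ik(1,2,4) by (simp add: mem c_def)
      moreover have "({i}, 0) \<notin> ?A k" using ik(1,2,4) by (simp add: mem)
      ultimately show False using ik(3) by simp
    next
      case True
      then have b2: "b2 > 0" using assms by simp
      have "card (T - {k}) = 2" using ik(2) T by simp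
      then have "(T - {k}, 0) \<in> ?A i" using ik(1,2,4) b2 by (auto simp: mem c_def)
      moreover have "(T - {k}, 0) \<notin> ?A k" by (simp add: mem)
      ultimately show False using ik(3) by simp
    qed
  qed
  have "card {v. (\<forall>i\<in>I. v \<in> ?A i) \<and> (\<forall>i\<in>T - I. v \<notin> ?A i)} = c I"
    if I: "I \<subseteq> T" "I \<noteq> {}" for I
  proof -
    have "{v. (\<forall>i\<in>I. v \<in> ?A i) \<and> (\<forall>i\<in>T - I. v \<notin> ?A i)} = {I} \<times> {..< c I}" (is "?L = ?R")
    proof (intro set_eqI iffI)
      fix v assume v: "v \<in> ?L"
      obtain J j where vJ [simp]: "v = (J, j)" by force
      obtain i where "i \<in> I" using I by auto
      then have J: "J \<subseteq> T" "j < c J" "I \<subseteq> J" using v by (auto simp: mem)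
      then have "J \<subseteq> I" using v by (auto simp: mem)
      then have "J = I" using J by simp
      then show "v \<in> ?R" using J by simp
    next
      fix v assume "v \<in> ?R"
      then show "v \<in> ?L" using I by (auto simp: mem)
    qed
    then show ?thesis by (simp add: card_cartesian_product)
  qed
  then show ?thesis
    unfolding has_profile_def T_def[symmetric] c_def[symmetric] using fin inj by simp
qed

lemma profile_unique:
  assumes A: "has_profile b1 b2 b3 A" and B: "has_profile b1 b2 b3 B"
  shows "hg_iso (A ` {1, 2, 3}) (B ` {1, 2, 3})"
proof -
  define T :: "nat set" where "T = {1, 2, 3}"
  define cA where "cA I = {v. (\<forall>i\<in>I. v \<in> A i) \<and> (\<forall>i\<in>T - I. v \<notin> A i)}" for I
  define cB where "cB I = {v. (\<forall>i\<in>I. v \<in> B i) \<and> (\<forall>i\<in>T - I. v \<notin> B i)}" for I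
  define tA where "tA v = {i\<in>T. v \<in> A i}" for v
  have "\<exists>g. bij_betw g (cA I) (cB I)" if I: "I \<subseteq> T" "I \<noteq> {}" for I
  proof (rule finite_same_card_bij)
    obtain i where i: "i \<in> I" using I by auto
    have "cA I \<subseteq> A i" "cB I \<subseteq> B i" using i by (auto simp: cA_def cB_def)
    then show "finite (cA I)" "finite (cB I)"
      using A B i I unfolding has_profile_def T_def by (meson finite_subset subsetD)+
    show "card (cA I) = card (cB I)"
      using A B I unfolding has_profile_def cA_def cB_def T_def by simp
  qed
  then obtain g where g: "bij_betw (g I) (cA I) (cB I)" if "I \<subseteq> T" "I \<noteq> {}" for I
    by metis
  define \<phi> where "\<phi> v = g (tA v) v" for v
  have inA: "v \<in> cA (tA v)" for v by (auto simp: cA_def tA_def)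
  have tA_eq: "tA v = I" if "v \<in> cA I" "I \<subseteq> T" for v I
    using that by (auto simp: cA_def tA_def)
  have im: "\<phi> ` A i = B i" if i: "i \<in> T" for i
  proof (intro set_eqI iffI)
    fix w assume "w \<in> \<phi> ` A i"
    then obtain v where v: "v \<in> A i" "w = \<phi> v" by auto
    then have "i \<in> tA v" "tA v \<subseteq> T" using i by (auto simp: tA_def)
    then have "w \<in> cB (tA v)" using g[of "tA v"] inA[of v] v(2)
      unfolding \<phi>_def bij_betw_def by blast
    then show "w \<in> B i" using \<open>i \<in> tA v\<close> by (auto simp: cB_def)
  next
    fix w assume w: "w \<in> B i"
    define I where "I = {k\<in>T. w \<in> B k}"
    have I: "I \<subseteq> T" "i \<in> I" "w \<in> cB I" using w i by (auto simp: I_def cB_def)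
    then obtain v where v: "v \<in> cA I" "w = g I v" using g[of I] unfolding bij_betw_def by blast
    then have "\<phi> v = w" "v \<in> A i" using I tA_eq[of v I] by (auto simp: \<phi>_def cA_def)
    then show "w \<in> \<phi> ` A i" by auto
  qed
  have "inj_on \<phi> (\<Union>i\<in>T. A i)"
  proof (rule inj_onI)
    fix u v assume uv: "u \<in> (\<Union>i\<in>T. A i)" "v \<in> (\<Union>i\<in>T. A i)" "\<phi> u = \<phi> v"
    have ne: "tA u \<noteq> {}" "tA v \<noteq> {}" "tA u \<subseteq> T" "tA v \<subseteq> T" using uv by (auto simp: tA_def)
    have "\<phi> u \<in> cB (tA u)" "\<phi> v \<in> cB (tA v)"
      using g[of "tA u"] g[of "tA v"] ne inA unfolding \<phi>_def bij_betw_def by blast+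
    then have "tA u = tA v" using uv(3) ne by (auto simp: cB_def)
    then show "u = v" using g[of "tA u"] ne inA uv(3)
      unfolding \<phi>_def bij_betw_def by (metis inj_onD)
  qed
  moreover have "\<phi> ` (\<Union>i\<in>T. A i) = (\<Union>i\<in>T. B i)" using im by (simp add: image_UN)
  moreover have "(\<lambda>e. \<phi> ` e) ` (A ` T) = B ` T" using im by (simp add: image_image)
  ultimately show ?thesis unfolding hg_iso_def bij_betw_def T_def[symmetric] by blast
qed

end

theory Submission
  imports Defs "HOL-Algebra.Algebraic_Closure" "HOL-Algebra.Multiplicative_Group"
    "HOL-Number_Theory.Residues"
begin

text \<open>
  An inversive plane of order \<open>q\<close> is a family of blocks, each of size \<open>q + 1\<close>, on
  \<open>q\<^sup>2 + 1\<close> points such that every three points lie on exactly one block.  Double counting shows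
  that two points lie on exactly \<open>q + 1\<close> common blocks and one point on exactly \<open>q\<^sup>2 + q\<close>.
  Dualise: let the blocks be vertices, and let every point give the edge of all blocks through it.
  Three edges then share one vertex, two of them share \<open>q\<close> vertices off the third, and each has
  \<open>(q\<^sup>2 + q) - 2 (q + 1) + 1 = q\<^sup>2 - q - 1\<close> vertices of its own, so \<^emph>\<open>every\<close> three of the
  \<open>q\<^sup>2 + 1\<close> edges form a copy of \<open>H(q\<^sup>2 - q - 1, q, 1)\<close>, and no \<open>H\<close>-free subgraph has more than
  two edges (\<open>inversive_plane.f_hg_eq_2\<close>).  Conversely two edges never contain a three-edge
  hypergraph, so the value is exactly 2.

  The plane comes from the field \<open>L\<close> with \<open>q\<^sup>2\<close> elements and its automorphism
  \<open>bar x = x ^ q\<close>, in the way the complex numbers give the Moebius plane: the points are those of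
  \<open>L\<close> and one point at infinity, the blocks are the lines \<open>a + K d\<close> over the fixed field
  \<open>K\<close> of \<open>bar\<close>, extended by infinity, and the circles on which \<open>(x - z) * bar (x - z)\<close> is a
  nonzero constant of \<open>K\<close>.  A line has \<open>q\<close> finite points because \<open>K\<close> has \<open>q\<close>
  elements; a circle has \<open>q + 1\<close> points because the norm is \<open>q + 1\<close> to one
  (\<open>power_map_image_and_kernel\<close>).  Seen from a point \<open>a\<close> of a circle with centre
  \<open>a + m\<close>, the circle has the equation \<open>u * bar u = u * bar m + bar u * m\<close> in
  \<open>u = x - a\<close>, which is linear in \<open>m\<close>.  By Cramer's rule two further points determine the
  centre when they are not on a line with \<open>a\<close>, and there is no solution when they are
  (\<open>block_through_three_finite\<close>).

  The field itself is cut out of an algebraic closure of the field with \<open>p\<close> elements as the set of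
  roots of \<open>X ^ Q - X\<close>, with \<open>q\<close> a power of \<open>p\<close> and \<open>Q = q\<^sup>2\<close> (\<open>finite_field_exists\<close>).
\<close>

section \<open>Hypergraphs in which all triples of edges are copies\<close>

lemma card_H3:
  assumes "b1 \<noteq> 0 \<or> b2 \<noteq> 0"
  shows "card (H3 b1 b2 b3) = 3"
  using H3_profile[OF assms, of b3] by (simp add: has_profile_def H3_def card_image)

lemma hg_iso_card:
  assumes "hg_iso S G"
  shows "card S = card G"
proof -
  obtain \<phi> where \<phi>: "bij_betw \<phi> (\<Union>S) (\<Union>G)" "(\<lambda>e. \<phi> ` e) ` S = G"
    using assms unfolding hg_iso_def by auto
  have "inj_on (\<lambda>e. \<phi> ` e) S"
    using \<phi>(1) unfolding bij_betw_def by (intro inj_onI) (metis Union_upper inj_on_image_eq_iff)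
  then show ?thesis using \<phi>(2) card_image by fastforce
qed

lemma ex_hg_ge_2:
  assumes "hypergraph F" "card F \<ge> 2" "card H = 3"
  shows "ex_hg F H \<ge> 2"
proof -
  have fin: "finite F" using assms(1) by (simp add: hypergraph_def)
  obtain G where G: "G \<subseteq> F" "card G = 2" using assms(2) obtain_subset_with_card_n by metis
  have "hg_free H G"
  proof -
    have False if "S \<subseteq> G" "hg_iso S H" for S
    proof -
      have "card S \<le> card G" using that(1) G(1) fin by (meson card_mono finite_subset)
      then show False using hg_iso_card[OF that(2)] G(2) assms(3) by simp
    qed
    then show ?thesis by (auto simp: hg_free_def is_copy_def)
  qed
  then have "2 \<in> {card G | G. G \<subseteq> F \<and> hg_free H G}" using G by (metis (mono_tags, lifting) mem_Collect_eq)
  moreover have "finite {card G | G. G \<subseteq> F \<and> hg_free H G}"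
    using fin by (auto intro!: finite_subset[of _ "card ` Pow F"])
  ultimately show ?thesis unfolding ex_hg_def using Max_ge by blast
qed

text \<open>
  A hypergraph with this property is extremal: three edges of any subgraph already contain a copy,
  while every hypergraph with \<open>m\<close> edges has a two-edge subgraph, which is too small for one.
\<close>

lemma f_hg_eq_2I:
  fixes F :: "nat set set"
  assumes F: "hypergraph F" "card F = m" and m: "m \<ge> 2" and H: "card H = 3"
    and triples: "\<And>G. G \<subseteq> F \<Longrightarrow> card G = 3 \<Longrightarrow> hg_iso G H"
  shows "f_hg m H = 2"
proof -
  have fin: "finite F" using F by (simp add: hypergraph_def)
  have "card G \<le> 2" if "G \<subseteq> F" "hg_free H G" for G
  proof (rule ccontr)
    assume "\<not> card G \<le> 2"
    then have "card G \<ge> 3" by simp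
    then obtain S where "S \<subseteq> G" "card S = 3" using obtain_subset_with_card_n by metis
    with triples[of S] that show False by (auto simp: hg_free_def is_copy_def)
  qed
  moreover have "card ({} :: nat set set) \<in> {card G | G. G \<subseteq> F \<and> hg_free H G}"
  proof -
    have "hg_free H ({} :: nat set set)"
      using hg_iso_card[of "{} :: nat set set" H] H by (auto simp: hg_free_def is_copy_def)
    then show ?thesis by blast
  qed
  moreover have "finite {card G | G. G \<subseteq> F \<and> hg_free H G}"
    using fin by (auto intro!: finite_subset[of _ "card ` Pow F"])
  ultimately have "ex_hg F H \<le> 2" unfolding ex_hg_def by (subst Max_le_iff) auto
  moreover have "ex_hg F H \<ge> 2" using ex_hg_ge_2[of F H] F m H by simp
  ultimately have "2 \<in> {ex_hg F H | F :: nat set set. hypergraph F \<and> card F = m}"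
    using F by (auto intro!: exI[of _ F])
  moreover have "x \<ge> 2" if "x \<in> {ex_hg F H | F :: nat set set. hypergraph F \<and> card F = m}" for x
    using that ex_hg_ge_2[of _ H] m H by auto
  ultimately show ?thesis unfolding f_hg_def by (rule cInf_eq_minimum)
qed

lemma double_count_const:
  assumes "finite S" "finite T"
    and "\<And>b. b \<in> T \<Longrightarrow> card {x\<in>S. x \<in> b} = k"
    and "\<And>x. x \<in> S \<Longrightarrow> card {b\<in>T. x \<in> b} = l"
  shows "card S * l = k * card T"
proof -
  have "(\<Sum>x\<in>S. card {b\<in>T. x \<in> b}) = k * card T"
    using assms(1,2,3) by (intro sum_multicount) auto
  then show ?thesis using assms(4) by simp
qed

section \<open>Counting blocks in an inversive plane\<close>

locale inversive_plane =
  fixes P :: "'a set" and B :: "'a set set" and q :: nat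
  assumes q: "q \<ge> 2"
    and finite_points: "finite P" and card_points: "card P = q^2 + 1"
    and blocks: "\<And>b. b \<in> B \<Longrightarrow> b \<subseteq> P"
    and card_block: "\<And>b. b \<in> B \<Longrightarrow> card b = q + 1"
    and unique_block: "\<And>x y z. \<lbrakk>x \<in> P; y \<in> P; z \<in> P; x \<noteq> y; x \<noteq> z; y \<noteq> z\<rbrakk>
        \<Longrightarrow> \<exists>!b. b \<in> B \<and> x \<in> b \<and> y \<in> b \<and> z \<in> b"
begin

lemma finite_blocks: "finite B"
  using finite_points blocks by (auto intro!: finite_subset[of B "Pow P"])

lemma finite_block: "b \<in> B \<Longrightarrow> finite b"
  using finite_points blocks finite_subset by metis

lemma card_blocks_through_three:
  assumes "x \<in> P" "y \<in> P" "z \<in> P" "x \<noteq> y" "x \<noteq> z" "y \<noteq> z"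
  shows "card {b\<in>B. x \<in> b \<and> y \<in> b \<and> z \<in> b} = 1"
proof -
  obtain c where "c \<in> B \<and> x \<in> c \<and> y \<in> c \<and> z \<in> c"
    "\<And>b. b \<in> B \<and> x \<in> b \<and> y \<in> b \<and> z \<in> b \<Longrightarrow> b = c"
    using unique_block[OF assms] by metis
  then have "{b\<in>B. x \<in> b \<and> y \<in> b \<and> z \<in> b} = {c}" by blast
  then show ?thesis by simp
qed

text \<open>
  Count the pairs of a third point and a block through \<open>x\<close>, \<open>y\<close> and that point: each of the
  \<open>q\<^sup>2 - 1 = (q - 1) (q + 1)\<close> other points is in one pair, and each block through \<open>x\<close> and
  \<open>y\<close> in \<open>q - 1\<close>.  The count for one point, below, is the same with one point fixed less.
\<close>

lemma card_blocks_through_two: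
  assumes "x \<in> P" "y \<in> P" "x \<noteq> y"
  shows "card {b\<in>B. x \<in> b \<and> y \<in> b} = q + 1"
proof -
  let ?S = "P - {x, y}" and ?T = "{b\<in>B. x \<in> b \<and> y \<in> b}"
  have "card {z\<in>?S. z \<in> b} = q - 1" if "b \<in> ?T" for b
  proof -
    have "{z\<in>?S. z \<in> b} = b - {x, y}" using that blocks by auto
    then show ?thesis using that assms card_block[of b] finite_block[of b]
      by (simp add: card_Diff_subset)
  qed
  moreover have "card {b\<in>?T. z \<in> b} = 1" if "z \<in> ?S" for z
    using card_blocks_through_three[of x y z] that assms by (auto simp: conj_assoc)
  ultimately have "card ?S * 1 = (q - 1) * card ?T"
    using finite_points finite_blocks by (intro double_count_const) auto
  moreover have "card ?S = q^2 + 1 - 2"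
    using assms finite_points card_points by (simp add: card_Diff_subset)
  moreover have "q^2 + 1 - 2 = (q - 1) * (q + 1)"
    using q by (cases q) (simp_all add: power2_eq_square)
  ultimately have "(q - 1) * card ?T = (q - 1) * (q + 1)" by simp
  then show ?thesis using q by (simp only: mult_cancel1) simp
qed

lemma card_blocks_through_one:
  assumes "x \<in> P"
  shows "card {b\<in>B. x \<in> b} = q^2 + q"
proof -
  let ?S = "P - {x}" and ?T = "{b\<in>B. x \<in> b}"
  have "card {z\<in>?S. z \<in> b} = q" if "b \<in> ?T" for b
  proof -
    have "{z\<in>?S. z \<in> b} = b - {x}" using that blocks by auto
    then show ?thesis using that assms card_block[of b] finite_block[of b]
      by (simp add: card_Diff_subset)
  qed
  moreover have "card {b\<in>?T. z \<in> b} = q + 1" if "z \<in> ?S" for z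
    using card_blocks_through_two[of x z] that assms by (auto simp: conj_assoc)
  ultimately have "card ?S * (q + 1) = q * card ?T"
    using finite_points finite_blocks by (intro double_count_const) auto
  moreover have "card ?S = q^2"
    using assms finite_points card_points by (simp add: card_Diff_subset)
  ultimately have "q * card ?T = q * (q^2 + q)" by (simp add: algebra_simps power2_eq_square)
  then show ?thesis using q by (simp only: mult_cancel1) simp
qed

lemma card_blocks_two_not_third:
  assumes "x \<in> P" "y \<in> P" "z \<in> P" "x \<noteq> y" "x \<noteq> z" "y \<noteq> z"
  shows "card {b\<in>B. x \<in> b \<and> y \<in> b \<and> z \<notin> b} = q"
proof -
  have "{b\<in>B. x \<in> b \<and> y \<in> b \<and> z \<notin> b} =
      {b\<in>B. x \<in> b \<and> y \<in> b} - {b\<in>B. x \<in> b \<and> y \<in> b \<and> z \<in> b}" by auto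
  also have "card \<dots> = q + 1 - 1"
    using finite_blocks card_blocks_through_two[of x y] card_blocks_through_three[of x y z] assms
    by (subst card_Diff_subset) auto
  finally show ?thesis by simp
qed

lemma card_blocks_one_not_others:
  assumes "x \<in> P" "y \<in> P" "z \<in> P" "x \<noteq> y" "x \<noteq> z" "y \<noteq> z"
  shows "card {b\<in>B. x \<in> b \<and> y \<notin> b \<and> z \<notin> b} = q^2 - q - 1"
proof -
  let ?X = "{b\<in>B. x \<in> b \<and> y \<notin> b \<and> z \<notin> b}"
  let ?Y = "{b\<in>B. x \<in> b \<and> y \<in> b}" and ?Z = "{b\<in>B. x \<in> b \<and> z \<in> b \<and> y \<notin> b}"
  have X: "?X = {b\<in>B. x \<in> b} - (?Y \<union> ?Z)" by auto
  have "card ?X = card {b\<in>B. x \<in> b} - card (?Y \<union> ?Z)"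
    unfolding X using finite_blocks by (intro card_Diff_subset) auto
  moreover have "card (?Y \<union> ?Z) = card ?Y + card ?Z"
    using finite_blocks by (intro card_Un_disjoint) auto
  ultimately have "card ?X = q^2 + q - ((q + 1) + q)"
    by (simp only: card_blocks_through_one[OF assms(1)] card_blocks_through_two[OF assms(1,2,4)]
      card_blocks_two_not_third[OF assms(1,3,2,5,4) assms(6)[symmetric]])
  then show ?thesis by simp
qed

text \<open>
  The edges are coded by an injection \<open>h\<close> of the blocks, so that the vertices can later be natural
  numbers.  The cardinality condition for an index set \<open>I\<close> counts the blocks that contain the
  points with index in \<open>I\<close> and avoid the others.
\<close>

lemma edges_profile:
  assumes p: "\<forall>i\<in>{1,2,3}. p i \<in> P" "inj_on p {1,2,3::nat}" and h: "inj_on h B"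
  shows "has_profile (q^2 - q - 1) q 1 (\<lambda>i. h ` {b\<in>B. p i \<in> b})"
proof -
  let ?A = "\<lambda>i. h ` {b\<in>B. p i \<in> b}"
  have d: "p 1 \<in> P" "p 2 \<in> P" "p 3 \<in> P" "p 1 \<noteq> p 2" "p 1 \<noteq> p 3" "p 2 \<noteq> p 3"
    using p(1) inj_onD[OF p(2), of 1 2] inj_onD[OF p(2), of 1 3] inj_onD[OF p(2), of 2 3] by auto
  note d' = d d(4-6)[symmetric]
  have mem: "h b \<in> ?A i \<longleftrightarrow> p i \<in> b" if "b \<in> B" for b i
    using that h by (auto dest: inj_onD)
  have pattern: "{v. (\<forall>i\<in>I. v \<in> ?A i) \<and> (\<forall>i\<in>{1,2,3} - I. v \<notin> ?A i)} =
      h ` {b\<in>B. (\<forall>i\<in>I. p i \<in> b) \<and> (\<forall>i\<in>{1,2,3} - I. p i \<notin> b)}" (is "?L = ?R")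
    if "I \<noteq> {}" for I
  proof (intro Set.set_eqI iffI)
    fix v assume v: "v \<in> ?L"
    with that obtain b where "b \<in> B" "v = h b" by auto
    with v mem show "v \<in> ?R" by (intro image_eqI[of _ _ b]) simp_all
  next
    fix v assume "v \<in> ?R"
    then obtain b where "b \<in> B" "v = h b" "\<forall>i\<in>I. p i \<in> b" "\<forall>i\<in>{1,2,3} - I. p i \<notin> b" by auto
    then show "v \<in> ?L" by (simp add: mem)
  qed
  have *: "card {v. (\<forall>i\<in>I. v \<in> ?A i) \<and> (\<forall>i\<in>{1,2,3} - I. v \<notin> ?A i)} =
      card {b\<in>B. (\<forall>i\<in>I. p i \<in> b) \<and> (\<forall>i\<in>{1,2,3} - I. p i \<notin> b)}" if "I \<noteq> {}" for I
    unfolding pattern[OF that] by (intro card_image inj_on_subset[OF h]) auto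
  have cards: "card {b\<in>B. (\<forall>i\<in>I. p i \<in> b) \<and> (\<forall>i\<in>{1,2,3} - I. p i \<notin> b)} =
      (if card I = 1 then q^2 - q - 1 else if card I = 2 then q else 1)"
    if I: "I \<subseteq> {1,2,3}" "I \<noteq> {}" for I
  proof -
    have "I \<in> Pow {1,2,3}" using I by simp
    then consider "I = {1}" | "I = {2}" | "I = {3}" | "I = {1,2}" | "I = {1,3}" | "I = {2,3}"
      | "I = {1,2,3}" using I(2) by (auto simp: Pow_insert)
    then show ?thesis
    proof cases
      case 1
      have "{1,2,3} - I = {2,3}" using 1 by auto
      then show ?thesis using 1 card_blocks_one_not_others[of "p 1" "p 2" "p 3"] d' by simp
    next
      case 2
      have "{1,2,3} - I = {1,3}" using 2 by auto
      then show ?thesis using 2 card_blocks_one_not_others[of "p 2" "p 1" "p 3"] d' by simp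
    next
      case 3
      have "{1,2,3} - I = {1,2}" using 3 by auto
      then show ?thesis using 3 card_blocks_one_not_others[of "p 3" "p 1" "p 2"] d' by simp
    next
      case 4
      have "{1,2,3} - I = {3}" using 4 by auto
      then show ?thesis using 4 card_blocks_two_not_third[of "p 1" "p 2" "p 3"] d' by simp
    next
      case 5
      have "{1,2,3} - I = {2}" using 5 by auto
      then show ?thesis using 5 card_blocks_two_not_third[of "p 1" "p 3" "p 2"] d' by simp
    next
      case 6
      have "{1,2,3} - I = {1}" using 6 by auto
      then show ?thesis using 6 card_blocks_two_not_third[of "p 2" "p 3" "p 1"] d' by simp
    next
      case 7
      then show ?thesis using card_blocks_through_three[of "p 1" "p 2" "p 3"] d' by simp
    qed
  qed
  have "inj_on ?A {1,2,3}"
  proof (rule inj_onI, rule ccontr)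
    fix i j assume ij: "i \<in> {1,2,3::nat}" "j \<in> {1,2,3}" "?A i = ?A j" "i \<noteq> j"
    then obtain k where k: "k \<in> {1,2,3}" "k \<noteq> i" "k \<noteq> j" by auto
    have "card {b\<in>B. p i \<in> b \<and> p k \<in> b \<and> p j \<notin> b} = q"
      using ij k p by (intro card_blocks_two_not_third) (simp_all only: inj_on_eq_iff, simp_all)
    then have "{b\<in>B. p i \<in> b \<and> p k \<in> b \<and> p j \<notin> b} \<noteq> {}" using q by force
    then obtain b where "b \<in> B" "p i \<in> b" "p j \<notin> b" by auto
    then have "h b \<in> ?A i" "h b \<notin> ?A j" using mem by simp_all
    then show False using ij by simp
  qed
  then show ?thesis
    unfolding has_profile_def using * cards finite_blocks by simp
qed

theorem f_hg_eq_2: "f_hg (q^2 + 1) (H3 (q^2 - q - 1) q 1) = 2"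
proof -
  obtain h :: "'a set \<Rightarrow> nat" where h: "inj_on h B"
    using finite_blocks finite_imp_inj_to_nat_seg by metis
  let ?e = "\<lambda>x. h ` {b\<in>B. x \<in> b}"
  have q0: "q \<noteq> 0" using q by simp
  have "3 \<le> card P" 
  proof -
    have "2 * 2 \<le> q * q" using q by (intro mult_le_mono)
    then show ?thesis using card_points by (simp add: power2_eq_square)
  qed
  have iso: "hg_iso (?e ` Q) (H3 (q^2 - q - 1) q 1)" "card (?e ` Q) = 3"
    if Q: "Q \<subseteq> P" "card Q = 3" for Q
  proof -
    have "card Q = card {1,2,3::nat}" using Q by simp
    moreover have "finite Q" using Q by (simp add: card_eq_0_iff card_ge_0_finite)
    ultimately obtain p where p: "bij_betw p {1,2,3::nat} Q"
      using finite_same_card_bij[of "{1,2,3::nat}" Q] by auto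
    have prof: "has_profile (q^2 - q - 1) q 1 (\<lambda>i. ?e (p i))"
      using p Q h by (intro edges_profile) (auto simp: bij_betw_def)
    have im: "(\<lambda>i. ?e (p i)) ` {1,2,3} = ?e ` Q"
      using p unfolding bij_betw_def by blast
    show "hg_iso (?e ` Q) (H3 (q^2 - q - 1) q 1)"
      using profile_unique[OF prof H3_profile] q0 unfolding im H3_def by simp
    then show "card (?e ` Q) = 3"
      using q0 by (simp add: hg_iso_card card_H3)
  qed
  \<comment> \<open>Two points with equal edges would extend to a triple of points with fewer than three edges.\<close>
  have inj: "inj_on ?e P"
  proof (rule inj_onI, rule ccontr)
    fix x y assume xy: "x \<in> P" "y \<in> P" "?e x = ?e y" "x \<noteq> y"
    then have "card {x, y} = 2" "{x, y} \<subseteq> P" by auto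
    then obtain Q where Q: "{x, y} \<subseteq> Q" "Q \<subseteq> P" "card Q = 3"
      using \<open>3 \<le> card P\<close> exists_subset_between[of "{x, y}" 3 P] finite_points by auto
    have "inj_on ?e Q" using iso(2)[OF Q(2,3)] Q(2,3) finite_points
      by (intro eq_card_imp_inj_on) (auto intro: finite_subset)
    then show False using xy Q(1) by (auto dest: inj_onD)
  qed
  show ?thesis
  proof (rule f_hg_eq_2I)
    show "hypergraph (?e ` P)"
      using finite_points finite_blocks by (auto simp: hypergraph_def)
    show "card (?e ` P) = q^2 + 1" using inj card_points by (simp add: card_image)
    show "card (H3 (q^2 - q - 1) q 1) = 3" using q0 by (intro card_H3) simp
    show "2 \<le> q^2 + 1" using \<open>3 \<le> card P\<close> card_points by simp
    fix G assume G: "G \<subseteq> ?e ` P" "card G = 3"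
    then obtain Q where Q: "Q \<subseteq> P" "G = ?e ` Q" by (meson subset_imageE)
    moreover have "card (?e ` Q) = card Q" using inj Q(1) by (intro card_image) (rule inj_on_subset)
    ultimately have "card Q = 3" using G by simp
    then show "hg_iso G (H3 (q^2 - q - 1) q 1)" using iso(1) Q by simp
  qed
qed

end

section \<open>The Frobenius map in commutative rings of prime characteristic\<close>

context cring begin

lemma binomial_cring:
  fixes n :: nat
  assumes [simp]: "x \<in> carrier R" "y \<in> carrier R"
  shows "(x \<oplus> y) [^] n = (\<Oplus>k\<in>{..n}. [(n choose k)] \<cdot> (x [^] k \<otimes> y [^] (n - k)))"
proof -
  define f where "f n k = [(n choose k)] \<cdot> (x [^] k \<otimes> y [^] (n - k))" for n k
  have closed [simp]: "f n k \<in> carrier R" for n k by (simp add: f_def)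
  have zero: "f n (Suc n) = \<zero>" for n by (simp add: f_def binomial_eq_0)
  have f0: "f (Suc n) 0 = f n 0 \<otimes> y" for n by (simp add: f_def)
  have pascal: "f (Suc n) (Suc k) = f n k \<otimes> x \<oplus> f n (Suc k) \<otimes> y" if "k \<le> n" for n k
  proof -
    have "f n k \<otimes> x = [(n choose k)] \<cdot> (x [^] Suc k \<otimes> y [^] (n - k))"
      using add_pow_ldistr[of "x [^] k \<otimes> y [^] (n - k)" x "n choose k"] by (simp add: f_def m_ac)
    moreover have "f n (Suc k) \<otimes> y = [(n choose Suc k)] \<cdot> (x [^] Suc k \<otimes> y [^] (n - k))"
    proof (cases "k = n")
      case False
      then have "n - k = Suc (n - Suc k)" using that by simp
      then have "y [^] (n - Suc k) \<otimes> y = y [^] (n - k)" by simp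
      then show ?thesis by (simp add: f_def add_pow_ldistr m_assoc)
    next
      case True
      then show ?thesis by (simp add: f_def binomial_eq_0)
    qed
    ultimately show ?thesis by (simp add: f_def add.nat_pow_mult add.m_comm)
  qed
  have "(x \<oplus> y) [^] n = finsum R (f n) {..n}"
  proof (induction n)
    case 0
    show ?case by (simp add: f_def)
  next
    case (Suc n)
    have 1: "finsum R (f n) {..n} = finsum R (\<lambda>k. f n (Suc k)) {..n} \<oplus> f n 0"
    proof -
      have "finsum R (f n) {..n} = finsum R (f n) {..Suc n}" using zero by simp
      then show ?thesis using finsum_Suc2[of "f n" n] by simp
    qed
    have 2: "finsum R (f (Suc n)) {..Suc n} = finsum R (\<lambda>k. f (Suc n) (Suc k)) {..n} \<oplus> f (Suc n) 0"
      by (rule finsum_Suc2) simp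
    have 3: "finsum R (\<lambda>k. f (Suc n) (Suc k)) {..n} = finsum R (\<lambda>k. f n k \<otimes> x \<oplus> f n (Suc k) \<otimes> y) {..n}"
      by (intro finsum_cong') (simp_all add: pascal Pi_def)
    have 4: "finsum R (\<lambda>k. f n k \<otimes> x \<oplus> f n (Suc k) \<otimes> y) {..n} =
        finsum R (f n) {..n} \<otimes> x \<oplus> finsum R (\<lambda>k. f n (Suc k)) {..n} \<otimes> y"
      by (simp add: finsum_addf finsum_ldistr Pi_def)
    have [simp]: "finsum R (f n) {..n} \<in> carrier R" "finsum R (\<lambda>k. f n (Suc k)) {..n} \<in> carrier R"
      by simp_all
    have "(x \<oplus> y) [^] Suc n = finsum R (f n) {..n} \<otimes> x \<oplus> finsum R (f n) {..n} \<otimes> y"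
      using Suc by (simp add: r_distr)
    moreover have "finsum R (f n) {..n} \<otimes> y = finsum R (\<lambda>k. f n (Suc k)) {..n} \<otimes> y \<oplus> f (Suc n) 0"
      unfolding f0 by (subst 1) (simp add: l_distr)
    ultimately show ?case unfolding 2 3 4 by (simp add: a_assoc)
  qed
  then show ?thesis unfolding f_def .
qed

lemma add_pow_eq_zero_of_dvd:
  fixes p m :: nat
  assumes "[p] \<cdot> \<one> = \<zero>" "p dvd m" "x \<in> carrier R"
  shows "[m] \<cdot> x = \<zero>"
proof -
  obtain k where m: "m = p * k" using assms(2) by auto
  have "[m] \<cdot> x = [k] \<cdot> ([p] \<cdot> (\<one> \<otimes> x))" using assms(3) by (simp add: m add.nat_pow_pow)
  also have "[p] \<cdot> (\<one> \<otimes> x) = \<zero>" using add_pow_ldistr[of \<one> x p] assms by simp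
  finally show ?thesis by simp
qed

text \<open>
  The inner binomial coefficients of a prime row are divisible by the prime, so only the two outer
  terms of the binomial expansion survive.
\<close>

lemma frobenius_prime:
  fixes p :: nat
  assumes p: "Factorial_Ring.prime p" "[p] \<cdot> \<one> = \<zero>" and xy: "x \<in> carrier R" "y \<in> carrier R"
  shows "(x \<oplus> y) [^] p = x [^] p \<oplus> y [^] p"
proof -
  define f where "f k = [(p choose k)] \<cdot> (x [^] k \<otimes> y [^] (p - k))" for k
  have closed: "f k \<in> carrier R" for k using xy by (simp add: f_def)
  have p1: "p > 1" using p(1) prime_gt_1_nat by blast
  have mid: "f k = \<zero>" if "0 < k" "k < p" for k
  proof -
    have "p dvd (p choose k)" using that p(1) by (intro dvd_choose_prime) auto
    then show ?thesis unfolding f_def using xy by (intro add_pow_eq_zero_of_dvd[OF p(2)]) simp_all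
  qed
  have "(x \<oplus> y) [^] p = finsum R f {..p}"
    unfolding f_def using xy by (rule binomial_cring)
  also have "finsum R f {..p} = finsum R f {0, p}"
    using closed p1
    by (intro add.finprod_mono_neutral_cong_right) (auto simp: Pi_def intro!: mid)
  also have "finsum R f {0, p} = f 0 \<oplus> f p"
    using closed p1 by (simp add: Pi_def)
  also have "f 0 \<oplus> f p = x [^] p \<oplus> y [^] p" using xy by (simp add: f_def a_comm)
  finally show ?thesis .
qed

lemma frobenius_power:
  fixes p n :: nat
  assumes p: "Factorial_Ring.prime p" "[p] \<cdot> \<one> = \<zero>" and xy: "x \<in> carrier R" "y \<in> carrier R"
  shows "(x \<oplus> y) [^] (p ^ n) = x [^] (p ^ n) \<oplus> y [^] (p ^ n)"
proof (induction n)
  case (Suc n)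
  have "(x \<oplus> y) [^] (p ^ Suc n) = ((x \<oplus> y) [^] (p ^ n)) [^] p"
    using xy by (simp add: nat_pow_pow mult.commute)
  also have "\<dots> = x [^] (p ^ Suc n) \<oplus> y [^] (p ^ Suc n)"
    using xy Suc frobenius_prime[OF p] by (simp add: nat_pow_pow mult.commute)
  finally show ?case .
qed (use xy in simp)

end

section \<open>Existence of finite fields\<close>

lemma (in ring_hom_ring) hom_add_pow_one_eq_zero:
  fixes p :: nat
  assumes "[p] \<cdot>\<^bsub>R\<^esub> \<one>\<^bsub>R\<^esub> = \<zero>\<^bsub>R\<^esub>"
  shows "[p] \<cdot>\<^bsub>S\<^esub> \<one>\<^bsub>S\<^esub> = \<zero>\<^bsub>S\<^esub>"
proof -
  have "h ([k] \<cdot>\<^bsub>R\<^esub> \<one>\<^bsub>R\<^esub>) = [k] \<cdot>\<^bsub>S\<^esub> \<one>\<^bsub>S\<^esub>" for k :: nat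
    by (induction k) simp_all
  from this[of p] assms show ?thesis by simp
qed

context algebraically_closed begin

text \<open>
  The fixed points are the roots of \<open>X ^ Q - X\<close>, which splits, so the point is that all roots are
  simple.  If \<open>a\<close> is a root, put \<open>Y = X - a\<close>; the Frobenius map
  of the polynomial ring gives \<open>Y ^ Q = X ^ Q - a\<close>, hence \<open>X ^ Q - X = Y ^ Q - Y\<close>.  As
  \<open>Y\<^sup>2\<close> divides \<open>Y ^ Q\<close>, it would divide \<open>Y\<close> if it divided the left-hand side.
\<close>

lemma card_frobenius_fixed_points:
  fixes p n :: nat
  assumes p: "Factorial_Ring.prime p" "[p] \<cdot> \<one> = \<zero>" and n: "n > 0"
  shows "card {x \<in> carrier L. x [^] (p ^ n) = x} = p ^ n"
proof -
  let ?U = "poly_ring L"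
  define Q where "Q = p ^ n"
  have Q: "Q \<ge> 2"
    using prime_ge_2_nat[OF p(1)] n self_le_power[of p n] unfolding Q_def by simp
  interpret UP: domain ?U using univ_poly_is_domain[OF carrier_is_subring] .
  interpret C: ring_hom_ring L ?U poly_of_const
    using canonical_embedding_ring_hom[OF carrier_is_subring] by simp
  have frob: "(f \<oplus>\<^bsub>?U\<^esub> g) [^]\<^bsub>?U\<^esub> Q = f [^]\<^bsub>?U\<^esub> Q \<oplus>\<^bsub>?U\<^esub> g [^]\<^bsub>?U\<^esub> Q"
    if "f \<in> carrier ?U" "g \<in> carrier ?U" for f g
    unfolding Q_def
    using UP.frobenius_power[OF p(1) C.hom_add_pow_one_eq_zero[OF p(2)] that] .
  have X: "X \<in> carrier ?U" using var_closed[OF carrier_is_subring] by simp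
  define F where "F = X [^]\<^bsub>?U\<^esub> Q \<ominus>\<^bsub>?U\<^esub> X"
  have F: "F \<in> carrier ?U" using X by (simp add: F_def)
  have degX: "degree X = 1" by (simp add: var_def)
  have degF: "degree F = Q"
  proof -
    have 1: "degree (X [^]\<^bsub>?U\<^esub> Q) = Q" using polynomial_pow_degree[OF X] degX by simp
    have 2: "degree (\<ominus>\<^bsub>?U\<^esub> X) = 1"
      using univ_poly_a_inv_degree[OF carrier_is_subring X] degX by simp
    have "degree F = max (degree (X [^]\<^bsub>?U\<^esub> Q)) (degree (\<ominus>\<^bsub>?U\<^esub> X))"
      unfolding F_def a_minus_def univ_poly_add
      using X 1 2 Q by (intro poly_add_degree_eq[OF carrier_is_subring]) (simp_all add: univ_poly_carrier)
    then show ?thesis using 1 2 Q by simp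
  qed
  have F_ne: "F \<noteq> []" using degF Q by auto
  have evalF: "eval F a = a [^] Q \<ominus> a" if a: "a \<in> carrier L" for a
  proof -
    interpret E: ring_hom_ring ?U L "\<lambda>f. eval f a"
      using eval_ring_hom[OF carrier_is_subring a] .
    show ?thesis using X a by (simp add: F_def a_minus_def E.hom_nat_pow eval_var)
  qed
  have root: "a \<in># roots F \<longleftrightarrow> a \<in> carrier L \<and> a [^] Q = a" for a
    using roots_mem_iff_is_root[OF F] F_ne evalF by (auto simp: is_root_def)
  have mult1: "alg_mult F a \<le> 1" if a: "a \<in> carrier L" "a [^] Q = a" for a
  proof (rule ccontr)
    assume "\<not> alg_mult F a \<le> 1"
    then have two: "([\<one>, \<ominus> a] [^]\<^bsub>?U\<^esub> (2::nat)) pdivides F"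
      using le_alg_mult_imp_pdivides[OF a(1) F, of 2] by simp
    define c where "c = poly_of_const (\<ominus> a)"
    have c: "c \<in> carrier ?U" using a by (simp add: c_def)
    define Y where "Y = X \<oplus>\<^bsub>?U\<^esub> c"
    have Y_eq: "Y = [\<one>, \<ominus> a]"
      using a(1) by (simp add: Y_def c_def var_def poly_of_const_def univ_poly_add)
    have Y: "Y \<in> carrier ?U" using X c by (simp add: Y_def)
    have "(\<ominus> a) [^] Q = \<ominus> a"
    proof -
      have "\<zero> = (a \<oplus> \<ominus> a) [^] Q" using a Q by (simp add: r_neg nat_pow_zero)
      also have "\<dots> = a \<oplus> (\<ominus> a) [^] Q" unfolding Q_def using a frobenius_power[OF p, of a "\<ominus> a" n] by (simp add: Q_def)
      finally show ?thesis using a minus_equality[of "(\<ominus> a) [^] Q" a] by (simp add: a_comm)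
    qed
    then have "c [^]\<^bsub>?U\<^esub> Q = c" using C.hom_nat_pow[of "\<ominus> a" Q] a(1) by (simp only: c_def a_inv_closed)
    then have "Y [^]\<^bsub>?U\<^esub> Q = X [^]\<^bsub>?U\<^esub> Q \<oplus>\<^bsub>?U\<^esub> c" using frob[OF X c] by (simp add: Y_def)
    then have "Y = Y [^]\<^bsub>?U\<^esub> Q \<ominus>\<^bsub>?U\<^esub> F"
      using X c unfolding F_def Y_def by (simp add: UP.minus_eq UP.minus_add UP.a_ac UP.r_neg UP.r_neg1 UP.r_neg2)
    moreover have "(Y [^]\<^bsub>?U\<^esub> (2::nat)) divides\<^bsub>?U\<^esub> (Y [^]\<^bsub>?U\<^esub> Q)"
      using polynomial_pow_division[OF Y Q] by (simp add: pdivides_def)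
    then obtain r where "r \<in> carrier ?U" "Y [^]\<^bsub>?U\<^esub> Q = Y [^]\<^bsub>?U\<^esub> (2::nat) \<otimes>\<^bsub>?U\<^esub> r" by (rule dividesE)
    moreover have "(Y [^]\<^bsub>?U\<^esub> (2::nat)) divides\<^bsub>?U\<^esub> F" using two by (simp add: pdivides_def Y_eq)
    then obtain s where "s \<in> carrier ?U" "F = Y [^]\<^bsub>?U\<^esub> (2::nat) \<otimes>\<^bsub>?U\<^esub> s" by (rule dividesE)
    ultimately have "r \<ominus>\<^bsub>?U\<^esub> s \<in> carrier ?U" "Y = Y [^]\<^bsub>?U\<^esub> (2::nat) \<otimes>\<^bsub>?U\<^esub> (r \<ominus>\<^bsub>?U\<^esub> s)"
      using Y by (simp_all add: UP.minus_eq UP.r_distr UP.r_minus)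
    then have "(Y [^]\<^bsub>?U\<^esub> (2::nat)) divides\<^bsub>?U\<^esub> Y" by (rule dividesI)
    then have "degree (Y [^]\<^bsub>?U\<^esub> (2::nat)) \<le> degree Y"
      using Y Y_eq by (intro pdivides_imp_degree_le[OF carrier_is_subring]) (auto simp: pdivides_def)
    then show False using polynomial_pow_degree[OF Y, of 2] Y_eq by simp
  qed
  have "count (roots F) a = 1" if "a \<in> set_mset (roots F)" for a
  proof -
    have "count (roots F) a \<le> 1"
      using that mult1[of a] root[of a] unfolding alg_mult_eq_count_roots[OF F] by blast
    moreover have "count (roots F) a > 0" using that by simp
    ultimately show ?thesis by linarith
  qed
  then have "size (roots F) = card (set_mset (roots F))"
    by (simp add: size_multiset_overloaded_eq)
  moreover have "set_mset (roots F) = {x \<in> carrier L. x [^] Q = x}" using root by auto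
  moreover have "size (roots F) = Q"
    using roots_over_carrier[OF F] degF by (simp add: splitted_def)
  ultimately show ?thesis by (simp add: Q_def)
qed

end

lemma residue_ring_add_pow:
  fixes p :: nat
  assumes "p > 1"
  shows "[p] \<cdot>\<^bsub>residue_ring (int p)\<^esub> \<one>\<^bsub>residue_ring (int p)\<^esub> = \<zero>\<^bsub>residue_ring (int p)\<^esub>"
proof -
  interpret residues "int p" "residue_ring (int p)" using assms by unfold_locales simp_all
  have "[k] \<cdot>\<^bsub>residue_ring (int p)\<^esub> \<one>\<^bsub>residue_ring (int p)\<^esub> = int k mod int p" for k :: nat
    using assms by (induction k) (simp_all add: res_zero_eq res_add_eq res_one_eq mod_simps add.commute)
  then show ?thesis by (simp add: res_zero_eq)
qed

text \<open>
  The roots of \<open>X ^ Q - X\<close>, \<open>Q = p ^ n\<close>, in an algebraic closure are the fixed points of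
  a map that respects sums, products and inverses, hence a subfield.  Additivity of the Frobenius map is
  recorded because it is the form in which the characteristic enters the geometry.
\<close>

theorem finite_field_exists:
  fixes p n :: nat
  assumes p: "Factorial_Ring.prime p" and n: "n > 0"
  obtains L :: "((int list \<times> nat) multiset \<Rightarrow> int) ring"
  where "field L" "card (carrier L) = p ^ n"
    "\<And>x y m. \<lbrakk>x \<in> carrier L; y \<in> carrier L\<rbrakk> \<Longrightarrow>
      (x \<oplus>\<^bsub>L\<^esub> y) [^]\<^bsub>L\<^esub> (p ^ m) = x [^]\<^bsub>L\<^esub> (p ^ m) \<oplus>\<^bsub>L\<^esub> y [^]\<^bsub>L\<^esub> (p ^ m)"
proof -
  let ?Q = "p ^ n"
  interpret R: residues_prime p "residue_ring (int p)" using p by unfold_locales simp_all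
  define M where "M = R.alg_closure"
  have M: "algebraic_closure M (R.indexed_const ` carrier (residue_ring (int p)))"
    and h: "R.indexed_const \<in> ring_hom (residue_ring (int p)) M"
    unfolding M_def by (rule R.alg_closureE)+
  interpret M: algebraic_closure M "R.indexed_const ` carrier (residue_ring (int p))" by (rule M)
  interpret H: ring_hom_ring "residue_ring (int p)" M R.indexed_const
    using h by (intro ring_hom_ringI2 R.ring_axioms M.ring_axioms)
  have char: "[p] \<cdot>\<^bsub>M\<^esub> \<one>\<^bsub>M\<^esub> = \<zero>\<^bsub>M\<^esub>"
    using prime_gt_1_nat[OF p] by (intro H.hom_add_pow_one_eq_zero residue_ring_add_pow)
  note frob = M.frobenius_power[OF p char]
  define S where "S = {x \<in> carrier M. x [^]\<^bsub>M\<^esub> ?Q = x}"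
  have card: "card S = ?Q" unfolding S_def by (rule M.card_frobenius_fixed_points[OF p char n])
  have Q: "?Q > 0" using prime_gt_0_nat[OF p] by simp
  have "subfield S M"
  proof (rule M.subfieldI')
    show "subring S M"
    proof (rule M.subringI)
      show "S \<subseteq> carrier M" "\<one>\<^bsub>M\<^esub> \<in> S" by (auto simp: S_def)
      show "\<ominus>\<^bsub>M\<^esub> x \<in> S" if "x \<in> S" for x
      proof -
        have x: "x \<in> carrier M" "x [^]\<^bsub>M\<^esub> ?Q = x" using that by (auto simp: S_def)
        have "x \<oplus>\<^bsub>M\<^esub> (\<ominus>\<^bsub>M\<^esub> x) [^]\<^bsub>M\<^esub> ?Q = (x \<oplus>\<^bsub>M\<^esub> \<ominus>\<^bsub>M\<^esub> x) [^]\<^bsub>M\<^esub> ?Q"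
          using frob[of x "\<ominus>\<^bsub>M\<^esub> x" n] x by simp
        also have "\<dots> = \<zero>\<^bsub>M\<^esub>" using x Q by (simp add: M.r_neg M.nat_pow_zero)
        finally have "(\<ominus>\<^bsub>M\<^esub> x) [^]\<^bsub>M\<^esub> ?Q = \<ominus>\<^bsub>M\<^esub> x"
          using x M.minus_equality[of "(\<ominus>\<^bsub>M\<^esub> x) [^]\<^bsub>M\<^esub> ?Q" x] by (simp add: M.a_comm)
        then show ?thesis using x by (simp add: S_def)
      qed
      show "x \<otimes>\<^bsub>M\<^esub> y \<in> S" if "x \<in> S" "y \<in> S" for x y
        using that by (auto simp: S_def M.nat_pow_distrib)
      show "x \<oplus>\<^bsub>M\<^esub> y \<in> S" if "x \<in> S" "y \<in> S" for x y
        using that frob[of x y n] by (auto simp: S_def)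
    qed
    show "inv\<^bsub>M\<^esub> x \<in> S" if "x \<in> S - {\<zero>\<^bsub>M\<^esub>}" for x
    proof -
      have x: "x \<in> carrier M" "x \<noteq> \<zero>\<^bsub>M\<^esub>" "x [^]\<^bsub>M\<^esub> ?Q = x" using that by (auto simp: S_def)
      then have u: "x \<in> Units M" by (simp add: M.field_Units)
      have "(x \<otimes>\<^bsub>M\<^esub> inv\<^bsub>M\<^esub> x) [^]\<^bsub>M\<^esub> ?Q = x [^]\<^bsub>M\<^esub> ?Q \<otimes>\<^bsub>M\<^esub> (inv\<^bsub>M\<^esub> x) [^]\<^bsub>M\<^esub> ?Q"
        using x u by (intro M.nat_pow_distrib) simp_all
      then have "x \<otimes>\<^bsub>M\<^esub> (inv\<^bsub>M\<^esub> x) [^]\<^bsub>M\<^esub> ?Q = \<one>\<^bsub>M\<^esub>" using x u by simp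
      then have "inv\<^bsub>M\<^esub> x = (inv\<^bsub>M\<^esub> x) [^]\<^bsub>M\<^esub> ?Q"
        using x u by (intro M.comm_inv_char) simp_all
      then show ?thesis using u by (simp add: S_def)
    qed
  qed
  then have "field (M\<lparr>carrier := S\<rparr>)" by (rule M.subfield_iff(2))
  moreover have "card (carrier (M\<lparr>carrier := S\<rparr>)) = ?Q" using card by simp
  moreover have "(x \<oplus>\<^bsub>M\<lparr>carrier := S\<rparr>\<^esub> y) [^]\<^bsub>M\<lparr>carrier := S\<rparr>\<^esub> (p ^ m) =
      x [^]\<^bsub>M\<lparr>carrier := S\<rparr>\<^esub> (p ^ m) \<oplus>\<^bsub>M\<lparr>carrier := S\<rparr>\<^esub> y [^]\<^bsub>M\<lparr>carrier := S\<rparr>\<^esub> (p ^ m)"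
    if "x \<in> carrier (M\<lparr>carrier := S\<rparr>)" "y \<in> carrier (M\<lparr>carrier := S\<rparr>)" for x y m
    using that frob[of x y m] by (simp add: S_def flip: M.nat_pow_consistent)
  ultimately show thesis using that by blast
qed

section \<open>Conjugation and norm in a quadratic extension of finite fields\<close>

text \<open>
  All nonempty fibres of \<open>x \<mapsto> x ^ d\<close> on the \<open>d * e\<close> nonzero elements have the size of
  the kernel, which is at most \<open>d\<close>, and the image lies among the at most \<open>e\<close> roots of
  \<open>y ^ e = 1\<close>.  As image size times kernel size is \<open>d * e\<close>, all these bounds are attained.
\<close>

lemma (in field) power_map_image_and_kernel:
  fixes d e :: nat
  assumes fin: "finite (carrier R)" and card: "card (carrier R - {\<zero>}) = d * e"
    and d: "d > 0" and e: "e > 0"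
  shows "card {x \<in> carrier R. x [^] d = \<one>} = d"
    and "(\<lambda>x. x [^] d) ` (carrier R - {\<zero>}) = {y \<in> carrier R. y [^] e = \<one>}"
    and "\<And>z. z \<in> carrier R - {\<zero>} \<Longrightarrow> card {x \<in> carrier R. x [^] d = z [^] d} = d"
proof -
  interpret M: group "Multiplicative_Group.mult_of R" by (rule field_mult_group)
  define G where "G = carrier R - {\<zero>}"
  define N where "N = {x \<in> carrier R. x [^] d = \<one>}"
  define I where "I = (\<lambda>x. x [^] d) ` G"
  have finG: "finite G" using fin by (simp add: G_def)
  have fiber: "card {x \<in> carrier R. x [^] d = z [^] d} = card N" if z: "z \<in> carrier R - {\<zero>}" for z
  proof -
    have zu: "z \<in> Units R" using z by (simp add: field_Units)
    have "{x \<in> carrier R. x [^] d = z [^] d} = (\<lambda>x. z \<otimes> x) ` N"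
    proof (intro Set.set_eqI iffI)
      fix x assume x: "x \<in> {x \<in> carrier R. x [^] d = z [^] d}"
      have "(inv z \<otimes> x) [^] d = (inv z) [^] d \<otimes> z [^] d"
        using x zu z by (simp add: nat_pow_distrib)
      also have "\<dots> = (inv z \<otimes> z) [^] d" using zu z by (intro nat_pow_distrib[symmetric]) simp_all
      also have "\<dots> = \<one>" using zu by simp
      finally have "inv z \<otimes> x \<in> N" using x zu by (simp add: N_def)
      moreover have "x = z \<otimes> (inv z \<otimes> x)" using x zu z by (simp flip: m_assoc)
      ultimately show "x \<in> (\<lambda>x. z \<otimes> x) ` N" by blast
    next
      fix x assume "x \<in> (\<lambda>x. z \<otimes> x) ` N"
      then show "x \<in> {x \<in> carrier R. x [^] d = z [^] d}"
        using z by (auto simp: N_def nat_pow_distrib)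
    qed
    moreover have "inj_on (\<lambda>x. z \<otimes> x) N"
      using z by (intro inj_onI) (auto simp: N_def m_lcancel)
    ultimately show ?thesis by (simp add: card_image)
  qed
  have order: "x [^] (d * e) = \<one>" if "x \<in> G" for x
  proof -
    have "x [^]\<^bsub>Multiplicative_Group.mult_of R\<^esub> order (Multiplicative_Group.mult_of R) = \<one>\<^bsub>Multiplicative_Group.mult_of R\<^esub>"
      using that by (intro M.pow_order_eq_1) (simp add: G_def)
    then show ?thesis using card by (simp add: order_def Multiplicative_Group.nat_pow_mult_of)
  qed
  have I_sub: "I \<subseteq> {y \<in> carrier R. y [^] e = \<one>}"
    using order by (auto simp: I_def G_def nat_pow_pow)
  have "(\<Sum>y\<in>I. card {x\<in>G. x [^] d = y}) = 1 * card G"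
  proof (rule sum_multicount)
    show "finite I" "finite G" using finG by (simp_all add: I_def)
    show "\<forall>x\<in>G. card {y\<in>I. x [^] d = y} = 1"
    proof
      fix x assume "x \<in> G"
      then have "{y\<in>I. x [^] d = y} = {x [^] d}" by (auto simp: I_def)
      then show "card {y\<in>I. x [^] d = y} = 1" by simp
    qed
  qed
  moreover have "card {x\<in>G. x [^] d = y} = card N" if "y \<in> I" for y
  proof -
    obtain z where z: "z \<in> G" "y = z [^] d" using \<open>y \<in> I\<close> by (auto simp: I_def)
    have "(z [^] d) [^] e = \<one>" using order[OF z(1)] z(1) by (simp add: G_def nat_pow_pow)
    then have "z [^] d \<noteq> \<zero>" using e by (auto simp: nat_pow_zero)
    then have "x \<noteq> \<zero>" if "x [^] d = z [^] d" for x
      using that d by (auto simp: nat_pow_zero)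
    then have "{x\<in>G. x [^] d = y} = {x\<in>carrier R. x [^] d = z [^] d}"
      using z by (auto simp: G_def)
    then show ?thesis using fiber[of z] z by (simp add: G_def)
  qed
  ultimately have count: "card I * card N = d * e" using card by (simp add: G_def)
  have N_le: "card N \<le> d" unfolding N_def using num_roots_le_deg[OF fin] d by simp
  have E_le: "card {y \<in> carrier R. y [^] e = \<one>} \<le> e" using num_roots_le_deg[OF fin] e by simp
  have I_le: "card I \<le> card {y \<in> carrier R. y [^] e = \<one>}"
    using I_sub fin by (intro card_mono) auto
  have "d * e \<le> e * card N"
    using count I_le E_le by (metis le_trans mult_le_mono1)
  then have N_eq: "card N = d" using N_le e by simp
  then have "card I = e" using count d by simp
  then have I_eq: "I = {y \<in> carrier R. y [^] e = \<one>}"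
    using I_le E_le I_sub fin by (intro card_subset_eq) auto
  show "card {x \<in> carrier R. x [^] d = \<one>} = d" using N_eq by (simp add: N_def)
  show "(\<lambda>x. x [^] d) ` (carrier R - {\<zero>}) = {y \<in> carrier R. y [^] e = \<one>}"
    using I_eq by (simp add: I_def G_def)
  show "card {x \<in> carrier R. x [^] d = z [^] d} = d" if "z \<in> carrier R - {\<zero>}" for z
    using fiber[OF that] N_eq by simp
qed

text \<open>
  A field with \<open>q\<^sup>2\<close> elements over its subfield with \<open>q\<close> elements, the latter being given
  only through the automorphism \<open>x \<mapsto> x ^ q\<close> that fixes it.
\<close>

locale quadratic_extension = field R for R (structure) +
  fixes q :: nat
  assumes q_ge_2: "q \<ge> 2"
    and card_carrier: "card (carrier R) = q^2"
    and power_q_add: "\<lbrakk>x \<in> carrier R; y \<in> carrier R\<rbrakk> \<Longrightarrow> (x \<oplus> y) [^] q = x [^] q \<oplus> y [^] q"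
begin

definition bar :: "'a \<Rightarrow> 'a" where "bar x = x [^] q"
definition base_field :: "'a set" where "base_field = {x \<in> carrier R. bar x = x}"
definition fnorm :: "'a \<Rightarrow> 'a" where "fnorm x = x \<otimes> bar x"
text \<open>
  For nonzero vectors this says that the quotient \<open>u / v\<close> is fixed by \<open>bar\<close>, that is, that
  \<open>u\<close> and \<open>v\<close> are proportional over the base field; the form without division makes it additive
  in each argument.
\<close>

definition parallel :: "'a \<Rightarrow> 'a \<Rightarrow> bool" where "parallel u v \<longleftrightarrow> u \<otimes> bar v = bar u \<otimes> v"
definition line :: "'a \<Rightarrow> 'a \<Rightarrow> 'a set" where "line a d = {x \<in> carrier R. parallel (x \<ominus> a) d}"
definition circle :: "'a \<Rightarrow> 'a \<Rightarrow> 'a set" where "circle z r = {x \<in> carrier R. fnorm (x \<ominus> z) = r}"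

lemma finite_carrier: "finite (carrier R)"
  using card_carrier q_ge_2 by (intro card_ge_0_finite) simp

lemma card_units: "card (carrier R - {\<zero>}) = (q + 1) * (q - 1)"
  using finite_carrier card_carrier q_ge_2
  by (cases q) (simp_all add: card_Diff_subset power2_eq_square)

lemma bar_closed [simp]: "x \<in> carrier R \<Longrightarrow> bar x \<in> carrier R"
  by (simp add: bar_def)

lemma bar_add: "\<lbrakk>x \<in> carrier R; y \<in> carrier R\<rbrakk> \<Longrightarrow> bar (x \<oplus> y) = bar x \<oplus> bar y"
  by (simp add: bar_def power_q_add)

lemma bar_mult: "\<lbrakk>x \<in> carrier R; y \<in> carrier R\<rbrakk> \<Longrightarrow> bar (x \<otimes> y) = bar x \<otimes> bar y"
  by (simp add: bar_def nat_pow_distrib)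

lemma bar_zero [simp]: "bar \<zero> = \<zero>"
  using q_ge_2 by (simp add: bar_def nat_pow_zero)

lemma bar_minus:
  assumes "x \<in> carrier R"
  shows "bar (\<ominus> x) = \<ominus> bar x"
proof -
  have "bar x \<oplus> bar (\<ominus> x) = \<zero>" using assms by (simp add: r_neg flip: bar_add)
  then show ?thesis using assms minus_equality[of "bar (\<ominus> x)" "bar x"] by (simp add: a_comm)
qed

lemma bar_diff: "\<lbrakk>x \<in> carrier R; y \<in> carrier R\<rbrakk> \<Longrightarrow> bar (x \<ominus> y) = bar x \<ominus> bar y"
  by (simp add: minus_eq bar_add bar_minus)

lemma bar_bar [simp]:
  assumes "x \<in> carrier R"
  shows "bar (bar x) = x"
proof (cases "x = \<zero>")
  case False
  interpret M: group "Multiplicative_Group.mult_of R" by (rule field_mult_group)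
  have "x [^]\<^bsub>Multiplicative_Group.mult_of R\<^esub> order (Multiplicative_Group.mult_of R) = \<one>\<^bsub>Multiplicative_Group.mult_of R\<^esub>"
    using False assms by (intro M.pow_order_eq_1) simp
  then have "x [^] ((q + 1) * (q - 1)) = \<one>" using card_units by (simp add: order_def Multiplicative_Group.nat_pow_mult_of)
  moreover have "q * q = (q + 1) * (q - 1) + 1" using q_ge_2 by (cases q) simp_all
  ultimately have "x [^] (q * q) = x" using assms by (simp only: nat_pow_mult[symmetric]) simp
  then show ?thesis using assms by (simp add: bar_def nat_pow_pow)
qed simp

lemma bar_eq_iff: "\<lbrakk>x \<in> carrier R; y \<in> carrier R\<rbrakk> \<Longrightarrow> bar x = bar y \<longleftrightarrow> x = y"
  by (metis bar_bar)

lemma bar_eq_zero_iff [simp]: "x \<in> carrier R \<Longrightarrow> bar x = \<zero> \<longleftrightarrow> x = \<zero>"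
  using bar_eq_iff[of x \<zero>] by simp

text \<open>
  The nonzero fixed points of \<open>bar\<close> are the roots of \<open>x ^ (q - 1) = 1\<close>, that is, the kernel of a
  power map whose exponent divides the order \<open>(q + 1) (q - 1)\<close> of the multiplicative group.
\<close>

lemma card_base_field: "card base_field = q"
proof -
  have iff: "bar x = x \<longleftrightarrow> x [^] (q - 1) = \<one>" if "x \<in> carrier R" "x \<noteq> \<zero>" for x
  proof -
    have "bar x = x [^] (q - 1) \<otimes> x"
      using nat_pow_Suc[of x "q - 1"] q_ge_2 by (simp add: bar_def del: nat_pow_Suc)
    then show ?thesis using that m_rcancel[of x "x [^] (q - 1)" \<one>] by simp
  qed
  have "\<zero> [^] (q - 1) \<noteq> \<one>" using q_ge_2 by (simp add: nat_pow_zero)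
  then have "base_field = insert \<zero> {x \<in> carrier R. x [^] (q - 1) = \<one>}"
    using iff by (auto simp: base_field_def)
  moreover have "card {x \<in> carrier R. x [^] (q - 1) = \<one>} = q - 1"
    using finite_carrier card_units q_ge_2
    by (intro power_map_image_and_kernel(1)[of _ "q + 1"]) (simp_all add: mult.commute)
  ultimately show ?thesis using finite_carrier q_ge_2 \<open>\<zero> [^] (q - 1) \<noteq> \<one>\<close> by simp
qed

lemma fnorm_eq_power: "x \<in> carrier R \<Longrightarrow> fnorm x = x [^] (q + 1)"
  using nat_pow_mult[of x 1 q] by (simp add: fnorm_def bar_def m_comm)

lemma fnorm_closed [simp]: "x \<in> carrier R \<Longrightarrow> fnorm x \<in> carrier R"
  by (simp add: fnorm_def)

lemma bar_fnorm: "x \<in> carrier R \<Longrightarrow> bar (fnorm x) = fnorm x"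
  by (simp add: fnorm_def bar_mult m_comm)

lemma fnorm_in_base_field: "x \<in> carrier R \<Longrightarrow> fnorm x \<in> base_field"
  by (simp add: base_field_def bar_fnorm)

lemma fnorm_eq_zero_iff: "x \<in> carrier R \<Longrightarrow> fnorm x = \<zero> \<longleftrightarrow> x = \<zero>"
  by (simp add: fnorm_def integral_iff)

text \<open>
  The norm is the power map with exponent \<open>q + 1\<close>, so its image consists of the roots of
  \<open>y ^ (q - 1) = 1\<close>; these are the nonzero elements of the base field.
\<close>

lemma card_fnorm_fiber:
  assumes "r \<in> base_field" "r \<noteq> \<zero>"
  shows "card {x \<in> carrier R. fnorm x = r} = q + 1"
proof -
  have r: "r \<in> carrier R" "bar r = r" using assms by (auto simp: base_field_def)
  have "r [^] (q - 1) \<otimes> r = \<one> \<otimes> r"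
    using nat_pow_Suc[of r "q - 1"] r q_ge_2 by (simp add: bar_def del: nat_pow_Suc)
  then have "r [^] (q - 1) = \<one>" using r assms(2) by (subst (asm) m_rcancel) simp_all
  moreover have "(\<lambda>x. x [^] (q + 1)) ` (carrier R - {\<zero>}) = {y \<in> carrier R. y [^] (q - 1) = \<one>}"
    using finite_carrier card_units q_ge_2 by (intro power_map_image_and_kernel(2)) simp_all
  ultimately have "r \<in> (\<lambda>x. x [^] (q + 1)) ` (carrier R - {\<zero>})" using r by simp
  then obtain z where z: "z \<in> carrier R - {\<zero>}" "r = z [^] (q + 1)" by auto
  have "{x \<in> carrier R. fnorm x = r} = {x \<in> carrier R. x [^] (q + 1) = z [^] (q + 1)}"
    using z fnorm_eq_power by auto
  also have "card \<dots> = q + 1"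
    using finite_carrier card_units q_ge_2 z
    by (intro power_map_image_and_kernel(3)[of _ "q - 1"]) simp_all
  finally show ?thesis .
qed

lemma parallel_sym: "\<lbrakk>u \<in> carrier R; v \<in> carrier R\<rbrakk> \<Longrightarrow> parallel u v \<longleftrightarrow> parallel v u"
  by (auto simp: parallel_def m_comm)

lemma parallel_diff: "\<lbrakk>u \<in> carrier R; v \<in> carrier R; d \<in> carrier R; parallel u d; parallel v d\<rbrakk> \<Longrightarrow> parallel (u \<ominus> v) d"
  by (simp add: parallel_def minus_eq bar_add bar_minus l_distr l_minus)

lemma parallel_add: "\<lbrakk>u \<in> carrier R; v \<in> carrier R; d \<in> carrier R; parallel u d; parallel v d\<rbrakk> \<Longrightarrow> parallel (u \<oplus> v) d"
  by (simp add: parallel_def bar_add l_distr)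

lemma parallel_trans:
  assumes c: "u \<in> carrier R" "v \<in> carrier R" "d \<in> carrier R" "v \<noteq> \<zero>" and uv: "parallel u v" and vd: "parallel v d"
  shows "parallel u d"
proof -
  have "v \<otimes> (u \<otimes> bar d) = u \<otimes> (v \<otimes> bar d)" using c by (simp add: m_lcomm)
  also have "\<dots> = (u \<otimes> bar v) \<otimes> d" using c vd by (simp add: parallel_def m_assoc)
  also have "\<dots> = v \<otimes> (bar u \<otimes> d)" using c uv by (simp add: parallel_def m_ac)
  finally show ?thesis using c by (simp add: parallel_def m_lcancel)
qed

text \<open>
  This makes two points determine their line.  It holds because parallelism to a fixed vector is
  additive, which moves the base point, and transitive through nonzero vectors, which changes the
  direction.
\<close>

lemma line_rebase:
  assumes c: "a \<in> carrier R" "d \<in> carrier R" "d \<noteq> \<zero>" and bc: "b \<in> line a d" "c \<in> line a d" "b \<noteq> c"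
  shows "line a d = line b (c \<ominus> b)"
proof -
  have b: "b \<in> carrier R" "parallel (b \<ominus> a) d" and c': "c \<in> carrier R" "parallel (c \<ominus> a) d"
    using bc by (auto simp: line_def)
  have shift: "(x \<ominus> a) \<ominus> (b \<ominus> a) = x \<ominus> b" "(x \<ominus> b) \<oplus> (b \<ominus> a) = x \<ominus> a" if "x \<in> carrier R" for x
    using that b(1) c(1) by algebra+
  have cb: "c \<ominus> b \<noteq> \<zero>" using b c' bc(3) by simp
  have "parallel (c \<ominus> b) d"
    using parallel_diff[of "c \<ominus> a" "b \<ominus> a" d] b c c' shift[of c] by simp
  then have cbd: "parallel (c \<ominus> b) d" "parallel d (c \<ominus> b)" using parallel_sym b c c' by simp_all
  have "parallel (x \<ominus> a) d \<longleftrightarrow> parallel (x \<ominus> b) (c \<ominus> b)" if x: "x \<in> carrier R" for x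
  proof
    assume "parallel (x \<ominus> a) d"
    then have "parallel (x \<ominus> b) d" using parallel_diff[of "x \<ominus> a" "b \<ominus> a" d] x b c shift[of x] by simp
    then show "parallel (x \<ominus> b) (c \<ominus> b)" using parallel_trans[of "x \<ominus> b" d "c \<ominus> b"] cbd x b c c' by simp
  next
    assume "parallel (x \<ominus> b) (c \<ominus> b)"
    then have "parallel (x \<ominus> b) d" using parallel_trans[of "x \<ominus> b" "c \<ominus> b" d] cbd cb x b c c' by simp
    then show "parallel (x \<ominus> a) d" using parallel_add[of "x \<ominus> b" "b \<ominus> a" d] x b c shift[of x] by simp
  qed
  then show ?thesis by (auto simp: line_def)
qed

lemma card_line:
  assumes c: "a \<in> carrier R" "d \<in> carrier R" "d \<noteq> \<zero>"
  shows "card (line a d) = q"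
proof -
  have parallel_iff: "parallel (k \<otimes> d) d \<longleftrightarrow> k \<in> base_field" if "k \<in> carrier R" for k
  proof -
    have "parallel (k \<otimes> d) d \<longleftrightarrow> k \<otimes> fnorm d = bar k \<otimes> fnorm d"
      using that c by (simp add: parallel_def fnorm_def bar_mult m_ac)
    then show ?thesis using that c by (auto simp: m_rcancel fnorm_eq_zero_iff base_field_def)
  qed
  have "line a d = (\<lambda>k. k \<otimes> d \<oplus> a) ` base_field"
  proof (intro Set.set_eqI iffI)
    fix x assume "x \<in> line a d"
    then have x: "x \<in> carrier R" "parallel (x \<ominus> a) d" by (auto simp: line_def)
    have d: "d \<in> Units R" using c by (simp add: field_Units)
    let ?k = "(x \<ominus> a) \<otimes> inv d"
    have k: "?k \<in> carrier R" "?k \<otimes> d = x \<ominus> a" using x c d by (simp_all add: m_assoc)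
    then have "?k \<in> base_field" using parallel_iff[of ?k] x by simp
    moreover have "x = ?k \<otimes> d \<oplus> a" unfolding k(2) using x c by (simp add: minus_eq a_assoc l_neg)
    ultimately show "x \<in> (\<lambda>k. k \<otimes> d \<oplus> a) ` base_field" by blast
  next
    fix x assume "x \<in> (\<lambda>k. k \<otimes> d \<oplus> a) ` base_field"
    then obtain k where k: "k \<in> base_field" "x = k \<otimes> d \<oplus> a" by auto
    then have kc: "k \<in> carrier R" by (simp add: base_field_def)
    have "x \<ominus> a = k \<otimes> d" using k kc c by (simp add: minus_eq a_assoc r_neg)
    then show "x \<in> line a d" using parallel_iff[of k] k kc c by (simp add: line_def)
  qed
  moreover have "inj_on (\<lambda>k. k \<otimes> d \<oplus> a) base_field"
    using c by (intro inj_onI) (simp add: base_field_def m_rcancel)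
  ultimately show ?thesis by (simp add: card_image card_base_field)
qed

lemma card_circle:
  assumes "z \<in> carrier R" "r \<in> base_field" "r \<noteq> \<zero>"
  shows "card (circle z r) = q + 1"
proof -
  have "circle z r = (\<lambda>x. x \<oplus> z) ` {x \<in> carrier R. fnorm x = r}"
  proof (intro Set.set_eqI iffI)
    fix x assume "x \<in> circle z r"
    then have "x = (x \<ominus> z) \<oplus> z" "x \<ominus> z \<in> {x \<in> carrier R. fnorm x = r}"
      using assms by (auto simp: circle_def minus_eq a_assoc l_neg)
    then show "x \<in> (\<lambda>x. x \<oplus> z) ` {x \<in> carrier R. fnorm x = r}" by blast
  next
    fix x assume "x \<in> (\<lambda>x. x \<oplus> z) ` {x \<in> carrier R. fnorm x = r}"
    then show "x \<in> circle z r"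
      using assms by (auto simp: circle_def minus_eq a_assoc r_neg)
  qed
  moreover have "inj_on (\<lambda>x. x \<oplus> z) {x \<in> carrier R. fnorm x = r}"
    using assms by (intro inj_onI) simp
  ultimately show ?thesis using card_fnorm_fiber[of r] assms by (simp add: card_image)
qed

section \<open>The inversive plane of a quadratic extension\<close>

lemma diff_self [simp]: "a \<in> carrier R \<Longrightarrow> a \<ominus> a = \<zero>"
  by simp

text \<open>
  The circle with centre \<open>m\<close> that passes through the origin; its equation is linear in
  \<open>m\<close> and \<open>bar m\<close>, because the terms \<open>fnorm m\<close> on both sides cancel.
\<close>

lemma circle_through_iff:
  assumes "u \<in> carrier R" "m \<in> carrier R"
  shows "fnorm (u \<ominus> m) = fnorm m \<longleftrightarrow> fnorm u = u \<otimes> bar m \<oplus> bar u \<otimes> m"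
proof -
  have "fnorm (u \<ominus> m) = fnorm m \<oplus> (fnorm u \<ominus> (u \<otimes> bar m \<oplus> bar u \<otimes> m))"
    using assms bar_closed[OF assms(1)] bar_closed[OF assms(2)]
    unfolding fnorm_def bar_diff[OF assms] by algebra
  then show ?thesis using assms by simp
qed

text \<open>
  Cramer's rule: eliminate \<open>bar m\<close> from the equations for two points \<open>u\<close>, \<open>v\<close>.  The
  determinant vanishes exactly when \<open>u\<close> and \<open>v\<close> are parallel.
\<close>

lemma centre_equation:
  assumes c: "u \<in> carrier R" "v \<in> carrier R" "m \<in> carrier R"
    and "fnorm u = u \<otimes> bar m \<oplus> bar u \<otimes> m" "fnorm v = v \<otimes> bar m \<oplus> bar v \<otimes> m"
  shows "(u \<otimes> bar v \<ominus> bar u \<otimes> v) \<otimes> m = u \<otimes> fnorm v \<ominus> v \<otimes> fnorm u"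
  using bar_closed[OF c(1)] bar_closed[OF c(2)] bar_closed[OF c(3)] c(1-3)
  unfolding assms(4,5) by algebra

text \<open>
  Cramer's rule treats \<open>m\<close> and \<open>bar m\<close> as two independent unknowns.  Its solution is
  consistent with the second being the conjugate of the first, because \<open>bar\<close> changes the sign of
  the determinant \<open>D\<close>.
\<close>

lemma centre_exists:
  assumes c: "u \<in> carrier R" "v \<in> carrier R" and not_parallel: "\<not> parallel u v"
  obtains m where "m \<in> carrier R" "fnorm u = u \<otimes> bar m \<oplus> bar u \<otimes> m"
    "fnorm v = v \<otimes> bar m \<oplus> bar v \<otimes> m"
proof -
  define D where "D = u \<otimes> bar v \<ominus> bar u \<otimes> v"
  define E where "E = u \<otimes> fnorm v \<ominus> v \<otimes> fnorm u"
  have D: "D \<in> carrier R" "D \<noteq> \<zero>" using c not_parallel by (simp_all add: D_def parallel_def)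
  have E: "E \<in> carrier R" using c by (simp add: E_def)
  have Du: "D \<in> Units R" using D by (simp add: field_Units)
  define m where "m = inv D \<otimes> E"
  have m: "m \<in> carrier R" "D \<otimes> m = E" using E Du D(1) m_assoc[of D "inv D" E] by (simp_all add: m_def)
  have "bar D = \<ominus> D"
    using c by (simp add: D_def bar_add bar_minus bar_mult minus_eq minus_add a_comm m_comm)
  then have "bar (D \<otimes> m) = \<ominus> (D \<otimes> bar m)"
    using bar_mult[OF D(1) m(1)] m(1) D(1) by (simp only: l_minus bar_closed)
  then have Dm': "D \<otimes> bar m = \<ominus> bar E" using m D by simp
  have E': "bar E = bar u \<otimes> fnorm v \<ominus> bar v \<otimes> fnorm u"
    using c by (simp add: E_def bar_diff bar_mult bar_fnorm)
  have key: "w \<otimes> \<ominus> bar E \<oplus> bar w \<otimes> E = D \<otimes> fnorm w" if "w = u \<or> w = v" for w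
    using that c bar_closed[OF c(1)] bar_closed[OF c(2)]
    unfolding E' unfolding E_def D_def fnorm_def by (elim disjE; hypsubst) (algebra, algebra)
  have "fnorm w = w \<otimes> bar m \<oplus> bar w \<otimes> m" if w: "w = u \<or> w = v" for w
  proof -
    have wc: "w \<in> carrier R" using w c by auto
    have "D \<otimes> (w \<otimes> bar m \<oplus> bar w \<otimes> m) = w \<otimes> (D \<otimes> bar m) \<oplus> bar w \<otimes> (D \<otimes> m)"
      using wc D(1) m(1) by (simp add: r_distr m_ac)
    also have "\<dots> = D \<otimes> fnorm w" unfolding Dm' m(2) by (rule key[OF w])
    finally show ?thesis using wc D m(1) by (subst (asm) m_lcancel) simp_all
  qed
  then show thesis using that m(1) by simp
qed

text \<open>
  With vanishing determinant the eliminated equation becomes \<open>u * v * (bar v - bar u) = 0\<close>, so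
  three distinct points of a line are not on a circle.
\<close>

lemma no_centre_if_parallel:
  assumes c: "u \<in> carrier R" "v \<in> carrier R" "m \<in> carrier R" and uv: "parallel u v" "u \<noteq> \<zero>" "v \<noteq> \<zero>" "u \<noteq> v"
    and eqs: "fnorm u = u \<otimes> bar m \<oplus> bar u \<otimes> m" "fnorm v = v \<otimes> bar m \<oplus> bar v \<otimes> m"
  shows False
proof -
  have "u \<otimes> fnorm v \<ominus> v \<otimes> fnorm u = \<zero>"
    using centre_equation[OF c eqs] c uv(1) by (simp add: parallel_def r_right_minus_eq)
  moreover have "u \<otimes> fnorm v \<ominus> v \<otimes> fnorm u = u \<otimes> v \<otimes> (bar v \<ominus> bar u)"
    using c bar_closed[OF c(1)] bar_closed[OF c(2)] unfolding fnorm_def by algebra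
  ultimately have "bar v \<ominus> bar u = \<zero>" using c uv by (simp add: integral_iff)
  then show False using c uv(4) bar_eq_iff by simp
qed

text \<open>
  \<open>None\<close> is the point at infinity.
\<close>

definition points :: "'a option set" where "points = insert None (Some ` carrier R)"

definition extended_lines :: "'a option set set" where
  "extended_lines = {insert None (Some ` line a d) | a d. a \<in> carrier R \<and> d \<in> carrier R - {\<zero>}}"

definition circles :: "'a option set set" where
  "circles = {Some ` circle z r | z r. z \<in> carrier R \<and> r \<in> base_field - {\<zero>}}"

definition blocks :: "'a option set set" where "blocks = extended_lines \<union> circles"

lemma mem_line_self: "\<lbrakk>a \<in> carrier R; d \<in> carrier R\<rbrakk> \<Longrightarrow> a \<in> line a d"
  by (simp add: line_def parallel_def)

lemma mem_line_end: "\<lbrakk>a \<in> carrier R; b \<in> carrier R\<rbrakk> \<Longrightarrow> b \<in> line a (b \<ominus> a)"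
  by (simp add: line_def parallel_def m_comm)

lemma extended_line_through_two:
  assumes l: "l \<in> extended_lines" and ab: "Some a \<in> l" "Some b \<in> l" "a \<noteq> b"
  shows "l = insert None (Some ` line a (b \<ominus> a))"
proof -
  obtain c d where "c \<in> carrier R" "d \<in> carrier R" "d \<noteq> \<zero>" "l = insert None (Some ` line c d)"
    using l by (auto simp: extended_lines_def)
  moreover from this have "line c d = line a (b \<ominus> a)"
    using ab by (intro line_rebase) auto
  ultimately show ?thesis by simp
qed

lemma extended_line_joining:
  assumes "a \<in> carrier R" "b \<in> carrier R" "a \<noteq> b"
  shows "insert None (Some ` line a (b \<ominus> a)) \<in> extended_lines"
    and "Some a \<in> insert None (Some ` line a (b \<ominus> a))"
    and "Some b \<in> insert None (Some ` line a (b \<ominus> a))"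
proof -
  have "b \<ominus> a \<in> carrier R - {\<zero>}" using assms by simp
  then show "insert None (Some ` line a (b \<ominus> a)) \<in> extended_lines"
    using assms(1) unfolding extended_lines_def by blast
qed (use assms mem_line_self[of a "b \<ominus> a"] mem_line_end[of a b] in auto)

lemma block_through_infinity:
  assumes "a \<in> carrier R" "b \<in> carrier R" "a \<noteq> b"
  shows "\<exists>!l. l \<in> blocks \<and> None \<in> l \<and> Some a \<in> l \<and> Some b \<in> l"
proof (rule ex1I[of _ "insert None (Some ` line a (b \<ominus> a))"])
  show "insert None (Some ` line a (b \<ominus> a)) \<in> blocks \<and> None \<in> insert None (Some ` line a (b \<ominus> a)) \<and>
      Some a \<in> insert None (Some ` line a (b \<ominus> a)) \<and> Some b \<in> insert None (Some ` line a (b \<ominus> a))"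
    using extended_line_joining[OF assms] by (simp add: blocks_def)
  fix l assume l: "l \<in> blocks \<and> None \<in> l \<and> Some a \<in> l \<and> Some b \<in> l"
  then have "l \<in> extended_lines" by (auto simp: blocks_def circles_def)
  then show "l = insert None (Some ` line a (b \<ominus> a))"
    using l assms(3) by (intro extended_line_through_two) simp_all
qed

text \<open>
  Here \<open>m\<close> is the centre seen from \<open>a\<close>; as \<open>a\<close> is on the circle, the radius is determined by
  \<open>m\<close>.
\<close>

lemma circle_through_three:
  assumes c: "a \<in> carrier R" "b \<in> carrier R" "c \<in> carrier R"
    and k: "k \<in> circles" "Some a \<in> k" "Some b \<in> k" "Some c \<in> k"
  obtains m where "m \<in> carrier R" "k = Some ` circle (a \<oplus> m) (fnorm m)"
    "fnorm (b \<ominus> a) = (b \<ominus> a) \<otimes> bar m \<oplus> bar (b \<ominus> a) \<otimes> m"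
    "fnorm (c \<ominus> a) = (c \<ominus> a) \<otimes> bar m \<oplus> bar (c \<ominus> a) \<otimes> m"
proof -
  obtain z r where z: "z \<in> carrier R" "k = Some ` circle z r" using k by (auto simp: circles_def)
  define m where "m = z \<ominus> a"
  have m: "m \<in> carrier R" "z = a \<oplus> m" using z(1) c(1) by (simp_all add: m_def, algebra)
  have shift: "x \<ominus> z = (x \<ominus> a) \<ominus> m" if "x \<in> carrier R" for x
    unfolding m_def using that z(1) c(1) by algebra
  have on: "fnorm ((x \<ominus> a) \<ominus> m) = r" if "x \<in> carrier R" "Some x \<in> k" for x
    using that shift by (auto simp: z(2) circle_def)
  have "r = fnorm (\<zero> \<ominus> m)" using on[of a] c k by simp
  then have "r = fnorm (\<ominus> m)" using m(1) by (simp add: minus_eq)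
  then have r: "r = fnorm m" using m(1) by (simp add: fnorm_def bar_minus l_minus r_minus)
  show thesis
    using that[of m] m z(2) r on[of b] on[of c] c k circle_through_iff[of "b \<ominus> a" m]
      circle_through_iff[of "c \<ominus> a" m] by simp
qed

lemma circle_from_centre:
  assumes c: "a \<in> carrier R" "m \<in> carrier R"
  shows "Some a \<in> Some ` circle (a \<oplus> m) (fnorm m)"
    and "x \<in> carrier R \<Longrightarrow> fnorm (x \<ominus> a) = (x \<ominus> a) \<otimes> bar m \<oplus> bar (x \<ominus> a) \<otimes> m \<Longrightarrow>
      Some x \<in> Some ` circle (a \<oplus> m) (fnorm m)"
proof -
  have shift: "x \<ominus> (a \<oplus> m) = (x \<ominus> a) \<ominus> m" if "x \<in> carrier R" for x
    using that c by algebra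
  show x: "Some x \<in> Some ` circle (a \<oplus> m) (fnorm m)"
    if "x \<in> carrier R" "fnorm (x \<ominus> a) = (x \<ominus> a) \<otimes> bar m \<oplus> bar (x \<ominus> a) \<otimes> m" for x
    using that c circle_through_iff[of "x \<ominus> a" m] shift[of x] by (simp add: circle_def)
  show "Some a \<in> Some ` circle (a \<oplus> m) (fnorm m)"
    using x[of a] c by (simp add: fnorm_def)
qed

text \<open>
  If \<open>a\<close>, \<open>b\<close>, \<open>c\<close> are collinear, their line is the only line and there is no circle
  through them; otherwise there is no line, and Cramer's rule gives exactly one centre.
\<close>

lemma block_through_three_finite:
  assumes c: "a \<in> carrier R" "b \<in> carrier R" "c \<in> carrier R" and ne: "a \<noteq> b" "a \<noteq> c" "b \<noteq> c"
  shows "\<exists>!l. l \<in> blocks \<and> Some a \<in> l \<and> Some b \<in> l \<and> Some c \<in> l"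
proof -
  let ?u = "b \<ominus> a" and ?v = "c \<ominus> a"
  let ?l = "insert None (Some ` line a ?u)"
  have uv: "?u \<in> carrier R" "?v \<in> carrier R" "?u \<noteq> \<zero>" "?v \<noteq> \<zero>" using c ne by simp_all
  have "?u \<noteq> ?v" using c ne(3) by (simp add: minus_eq)
  have on_line: "Some c \<in> ?l \<longleftrightarrow> parallel ?u ?v"
    using c uv parallel_sym by (auto simp: line_def)
  show ?thesis
  proof (cases "parallel ?u ?v")
    case True
    show ?thesis
    proof (rule ex1I[of _ ?l])
      show "?l \<in> blocks \<and> Some a \<in> ?l \<and> Some b \<in> ?l \<and> Some c \<in> ?l"
        using extended_line_joining[OF c(1,2) ne(1)] True on_line by (simp add: blocks_def)
      fix l assume l: "l \<in> blocks \<and> Some a \<in> l \<and> Some b \<in> l \<and> Some c \<in> l"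
      have "l \<notin> circles"
      proof
        assume "l \<in> circles"
        then obtain m where "m \<in> carrier R"
          "fnorm ?u = ?u \<otimes> bar m \<oplus> bar ?u \<otimes> m" "fnorm ?v = ?v \<otimes> bar m \<oplus> bar ?v \<otimes> m"
          using circle_through_three[OF c] l by metis
        then show False using no_centre_if_parallel uv True \<open>?u \<noteq> ?v\<close> by blast
      qed
      then show "l = ?l"
        using l ne(1) by (intro extended_line_through_two) (simp_all add: blocks_def)
    qed
  next
    case False
    obtain m where m: "m \<in> carrier R"
      "fnorm ?u = ?u \<otimes> bar m \<oplus> bar ?u \<otimes> m" "fnorm ?v = ?v \<otimes> bar m \<oplus> bar ?v \<otimes> m"
      using centre_exists[OF uv(1,2) False] by blast
    let ?k = "Some ` circle (a \<oplus> m) (fnorm m)"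
    have "m \<noteq> \<zero>" using m(2) uv by (auto simp: fnorm_eq_zero_iff)
    then have "?k \<in> circles"
      using m(1) c(1) fnorm_in_base_field fnorm_eq_zero_iff by (auto simp: circles_def)
    show ?thesis
    proof (rule ex1I[of _ ?k])
      show "?k \<in> blocks \<and> Some a \<in> ?k \<and> Some b \<in> ?k \<and> Some c \<in> ?k"
        using \<open>?k \<in> circles\<close> circle_from_centre[OF c(1) m(1)] c m by (simp add: blocks_def)
      fix l assume l: "l \<in> blocks \<and> Some a \<in> l \<and> Some b \<in> l \<and> Some c \<in> l"
      have "l \<notin> extended_lines"
        using extended_line_through_two[of l a b] l ne(1) on_line False by auto
      then have "l \<in> circles" using l by (simp add: blocks_def)
      then obtain m' where m': "m' \<in> carrier R" "l = Some ` circle (a \<oplus> m') (fnorm m')"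
        "fnorm ?u = ?u \<otimes> bar m' \<oplus> bar ?u \<otimes> m'" "fnorm ?v = ?v \<otimes> bar m' \<oplus> bar ?v \<otimes> m'"
        using circle_through_three[OF c] l by metis
      have "?u \<otimes> bar ?v \<ominus> bar ?u \<otimes> ?v \<noteq> \<zero>" using False uv by (simp add: parallel_def)
      moreover have "(?u \<otimes> bar ?v \<ominus> bar ?u \<otimes> ?v) \<otimes> m' = (?u \<otimes> bar ?v \<ominus> bar ?u \<otimes> ?v) \<otimes> m"
        using centre_equation[OF uv(1,2) m'(1,3,4)] centre_equation[OF uv(1,2) m] by simp
      ultimately have "m' = m" using m(1) m'(1) uv by (subst (asm) m_lcancel) simp_all
      then show "l = ?k" using m'(2) by simp
    qed
  qed
qed

sublocale plane: inversive_plane points blocks q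
proof
  show "q \<ge> 2" by (rule q_ge_2)
  show "finite points" using finite_carrier by (simp add: points_def)
  show "card points = q^2 + 1"
    using finite_carrier card_carrier by (simp add: points_def card_image)
  show "b \<subseteq> points" if "b \<in> blocks" for b
    using that by (auto simp: blocks_def extended_lines_def circles_def points_def line_def circle_def)
  show "card b = q + 1" if "b \<in> blocks" for b
  proof -
    have "finite (line a d)" for a d using finite_carrier by (simp add: line_def)
    then show ?thesis
      using that by (auto simp: blocks_def extended_lines_def circles_def card_image card_line card_circle)
  qed
  show "\<exists>!b. b \<in> blocks \<and> x \<in> b \<and> y \<in> b \<and> z \<in> b"
    if pts: "x \<in> points" "y \<in> points" "z \<in> points" "x \<noteq> y" "x \<noteq> z" "y \<noteq> z" for x y z
  proof (cases "None \<in> {x, y, z}")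
    case False
    then have not_None: "x \<noteq> None \<and> y \<noteq> None \<and> z \<noteq> None"
      by (cases x; cases y; cases z) simp_all
    then obtain a b c where abc: "x = Some a" "y = Some b" "z = Some c"
      "a \<in> carrier R" "b \<in> carrier R" "c \<in> carrier R" "a \<noteq> b" "a \<noteq> c" "b \<noteq> c"
      using pts not_None by (auto simp: points_def)
    show ?thesis using block_through_three_finite[OF abc(4-9)] unfolding abc(1-3) .
  next
    case True
    then consider "x = None" | "y = None" | "z = None" by auto
    then show ?thesis
    proof cases
      case 1
      then obtain a b where ab: "y = Some a" "z = Some b" "a \<in> carrier R" "b \<in> carrier R" "a \<noteq> b"
        using pts by (auto simp: points_def)
      show ?thesis using block_through_infinity[OF ab(3-5)] unfolding 1 ab(1,2) .
    next
      case 2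
      then obtain a b where ab: "x = Some a" "z = Some b" "a \<in> carrier R" "b \<in> carrier R" "a \<noteq> b"
        using pts by (auto simp: points_def)
      show ?thesis using block_through_infinity[OF ab(3-5)] unfolding 2 ab(1,2) by (simp only: conj_ac)
    next
      case 3
      then obtain a b where ab: "x = Some a" "y = Some b" "a \<in> carrier R" "b \<in> carrier R" "a \<noteq> b"
        using pts by (auto simp: points_def)
      show ?thesis using block_through_infinity[OF ab(3-5)] unfolding 3 ab(1,2) by (simp only: conj_ac)
    qed
  qed
qed

end

section \<open>The extremal value\<close>

theorem theorem2p10:
  fixes q :: nat
  assumes "primepow q" and "odd q"
  shows "f_hg (q^2 + 1) (H3 (q^2 - q - 1) q 1) = 2"
proof -
  obtain p k where p: "Factorial_Ring.prime p" and k: "k > 0" and q: "q = p ^ k"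
    using assms(1) by (auto simp: primepow_def)
  obtain L :: "((int list \<times> nat) multiset \<Rightarrow> int) ring" where
    L: "field L" "card (carrier L) = p ^ (2 * k)"
    and additive: "\<And>x y m. \<lbrakk>x \<in> carrier L; y \<in> carrier L\<rbrakk> \<Longrightarrow>
      (x \<oplus>\<^bsub>L\<^esub> y) [^]\<^bsub>L\<^esub> (p ^ m) = x [^]\<^bsub>L\<^esub> (p ^ m) \<oplus>\<^bsub>L\<^esub> y [^]\<^bsub>L\<^esub> (p ^ m)"
    using finite_field_exists[OF p, of "2 * k"] k by auto
  interpret L: field L by (rule L(1))
  interpret quadratic_extension L q
  proof
    show "q \<ge> 2" using primepow_gt_Suc_0[OF assms(1)] by simp
    show "card (carrier L) = q^2" using L(2) by (simp add: q power_mult mult.commute)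
  qed (use additive q in simp)
  show ?thesis by (rule plane.f_hg_eq_2)
qed

end
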